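(* Let $\Gamma$ be a connected negative definite plumbing graph whose plumbed 3-manifold $M=M(\Gamma)$ is a rational homology sphere, and assume that its set of nodes $\mathcal{N}$ is non-empty. Then for every $h\in H$ $$Q_{[Z_K]-h,\mathcal{N}}(Z_K-r_h)=-\mathfrak{sw}_h^{norm}(M).$$
   Context: Graph and lattices. $\Gamma$ is a tree with all genus decorations zero (equivalent to $M$ being a rational homology sphere), with vertex set $\mathcal{V}$; $\delta_v$ is the valency of $v$, and $\mathcal{N}=\{v:\delta_v\ge3\}$ is the set of nodes. $L=\mathbb{Z}\langle E_v\rangle_{v\in\mathcal{V}}$ carries the negative definite intersection form $(\,,\,)$: $(E_v,E_v)$ is the Euler decoration of $v$, and for $v\neq w$, $(E_v,E_w)=1$ if $v,w$ are adjacent, $0$ otherwise. $L'=\{l'\in L\otimes\mathbb{Q}:(l',L)\subset\mathbb{Z}\}$, generated by $E_v^*$ with $(E_v^*,E_w)=-1$ if $v=w$ and $0$ otherwise. $H=L'/L\simeq H_1(M,\mathbb{Z})$, $[x]$ is the class of $x\in L'$. Write $l'=\sum_vl'_vE_v$ and $l'|_{\mathcal{I}}=(l'_v)_{v\in\mathcal{I}}$ for $\mathcal{I}\subset\mathcal{V}$. For $h\in H$, $r_h\in L'$ is the unique representative of $h$ with all $E_v$-coordinates in $[0,1)$. $E=\sum_vE_v$; $Z_K\in L'$ is determined by $(Z_K,E_v)=(E_v,E_v)+2$ for all $v$, equivalently $Z_K-E=\sum_v(\delta_v-2)E_v^*$; $K=-Z_K$. For vectors, $a\ge b$ means $a_v\ge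 b_v$ for all coordinates. Series and counting functions. $Z(\mathbf{t})=\sum_{l'\in L'}z(l')\mathbf{t}^{l'}$ is the Taylor expansion at the origin of $f(\mathbf{t})=\prod_{v\in\mathcal{V}}(1-\mathbf{t}^{E_v^*})^{\delta_v-2}$, with $\mathbf{t}^{l'}=\prod_vt_v^{l'_v}$. For non-empty $\mathcal{I}\subset\mathcal{V}$, $g\in H$ and $x\in L'$ with $[x]=g$, $Q_{g,\mathcal{I}}(x)=\sum_{l'|_{\mathcal{I}}\not\geq x|_{\mathcal{I}},\,[l']=g}z(l')$ (a finite sum); put $Q_g:=Q_{g,\mathcal{V}}$. Seiberg–Witten invariants. $\widetilde X$ is the plumbed 4-manifold with $\partial\widetilde X=M$; $\sigma_{can}\in\mathrm{Spin}^c(M)$ is the restriction of the $spin^c$-structure $\widetilde\sigma_{can}$ of $\widetilde X$ with $c_1(\widetilde\sigma_{can})=Z_K$; $\mathrm{Spin}^c(M)$ is an $H$-torsor with action $*$. $\mathfrak{sw}_\sigma(M)\in\mathbb{Q}$ is the Seiberg–Witten invariant of $M$ for $\sigma\in\mathrm{Spin}^c(M)$. The sign convention is the one for which the following known theorem of Némethi holds: for every $l'\in -K+\mathbb{Z}_{>0}\langle E_v^*\rangle_{v\in\mathcal{V}}$, $-Q_{[l']}(l')=\frac{(K+2l')^2+|\mathcal{V}|}{8}+\mathfrak{sw}_{[-l']*\sigma_{can}}(M)$, where $(x)^2=(x,x)$. The $r_h$-normalized Seiberg–Witten invariant is $$\mathfrak{sw}_h^{norm}(M)=\mathfrak{sw}_{-h*\sigma_{can}}(M)+\frac{(K+2r_h)^2+|\mathcal{V}|}{8}.$$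 *)

theory Defs
  imports
    "HOL-Analysis.Analysis"
    "HOL-Algebra.Coset"
    "HOL-Computational_Algebra.Formal_Power_Series"
begin

text \<open>
  A plumbing graph on the vertex set \<^typ>\<open>'v\<close>.  Only simple graphs are modelled; this is no loss
  here, since the plumbed manifold is a rational homology sphere only if the graph is a tree.
\<close>

record 'v plumbing_graph =
  adj :: "'v \<Rightarrow> 'v \<Rightarrow> bool"
  euler :: "'v \<Rightarrow> int"
  genus :: "'v \<Rightarrow> nat"

definition plumbing_graph :: "'v plumbing_graph \<Rightarrow> bool" where
  "plumbing_graph \<Gamma> \<longleftrightarrow> symp (adj \<Gamma>) \<and> irreflp (adj \<Gamma>)"

definition connected_graph :: "'v plumbing_graph \<Rightarrow> bool" where
  "connected_graph \<Gamma> \<longleftrightarrow> (\<forall>v w. (adj \<Gamma>)\<^sup>*\<^sup>* v w)"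

definition cycle_in :: "'v plumbing_graph \<Rightarrow> 'v list \<Rightarrow> bool" where
  "cycle_in \<Gamma> p \<longleftrightarrow>
     length p \<ge> 3 \<and> distinct p \<and> successively (adj \<Gamma>) p \<and> adj \<Gamma> (last p) (hd p)"

definition tree_graph :: "'v plumbing_graph \<Rightarrow> bool" where
  "tree_graph \<Gamma> \<longleftrightarrow> connected_graph \<Gamma> \<and> (\<nexists>p. cycle_in \<Gamma> p)"

text \<open>
  For a connected negative definite graph this says that the plumbed 3-manifold is a rational
  homology sphere.
\<close>

definition rational_homology_sphere :: "'v plumbing_graph \<Rightarrow> bool" where
  "rational_homology_sphere \<Gamma> \<longleftrightarrow> tree_graph \<Gamma> \<and> (\<forall>v. genus \<Gamma> v = 0)"

definition valency :: "'v plumbing_graph \<Rightarrow> 'v \<Rightarrow> nat" where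
  "valency \<Gamma> v = card {w. adj \<Gamma> v w}"

definition nodes :: "'v plumbing_graph \<Rightarrow> 'v set" where
  "nodes \<Gamma> = {v. valency \<Gamma> v \<ge> 3}"


text \<open>
  Elements of \<open>L \<otimes> \<rat>\<close> are vectors of \<open>E\<^sub>v\<close>-coordinates; the base vector \<open>E\<^sub>v\<close> is \<open>axis v 1\<close>.
\<close>

definition intersection_number :: "'v plumbing_graph \<Rightarrow> 'v \<Rightarrow> 'v \<Rightarrow> int" where
  "intersection_number \<Gamma> v w =
     (if v = w then euler \<Gamma> v else if adj \<Gamma> v w then 1 else 0)"

definition iform :: "'v::finite plumbing_graph \<Rightarrow> rat ^ 'v \<Rightarrow> rat ^ 'v \<Rightarrow> rat" where
  "iform \<Gamma> x y = (\<Sum>v\<in>UNIV. \<Sum>w\<in>UNIV. x $ v * of_int (intersection_number \<Gamma> v w) * y $ w)"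

definition negative_definite :: "'v::finite plumbing_graph \<Rightarrow> bool" where
  "negative_definite \<Gamma> \<longleftrightarrow> (\<forall>x. x \<noteq> 0 \<longrightarrow> iform \<Gamma> x x < 0)"

definition L_lattice :: "(rat ^ 'v::finite) set" where
  "L_lattice = {x. \<forall>v. x $ v \<in> \<int>}"

definition L_dual :: "'v::finite plumbing_graph \<Rightarrow> (rat ^ 'v) set" where
  "L_dual \<Gamma> = {x. \<forall>y\<in>L_lattice. iform \<Gamma> x y \<in> \<int>}"

definition E_dual :: "'v::finite plumbing_graph \<Rightarrow> 'v \<Rightarrow> rat ^ 'v" where
  "E_dual \<Gamma> v = (THE x. \<forall>w. iform \<Gamma> x (axis w 1) = (if v = w then - 1 else 0))"

definition L_dual_group :: "'v::finite plumbing_graph \<Rightarrow> (rat ^ 'v) monoid" where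
  "L_dual_group \<Gamma> = \<lparr>carrier = L_dual \<Gamma>, mult = (+), one = 0\<rparr>"

definition H_group :: "'v::finite plumbing_graph \<Rightarrow> (rat ^ 'v) set monoid" where
  "H_group \<Gamma> = L_dual_group \<Gamma> Mod L_lattice"

definition H_class :: "'v::finite plumbing_graph \<Rightarrow> rat ^ 'v \<Rightarrow> (rat ^ 'v) set" where
  "H_class \<Gamma> x = L_lattice #>\<^bsub>L_dual_group \<Gamma>\<^esub> x"

definition r_rep :: "(rat ^ 'v::finite) set \<Rightarrow> rat ^ 'v" where
  "r_rep h = (THE r. r \<in> h \<and> (\<forall>v. 0 \<le> r $ v \<and> r $ v < 1))"

definition Z_K :: "'v::finite plumbing_graph \<Rightarrow> rat ^ 'v" where
  "Z_K \<Gamma> = (THE x. \<forall>v. iform \<Gamma> x (axis v 1) = iform \<Gamma> (axis v 1) (axis v 1) + 2)"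


text \<open>
  Since the \<open>E\<^sub>v\<^sup>*\<close> are linearly independent, the monomials \<open>t\<^sup>E\<close> with \<open>E = E\<^sub>v\<^sup>*\<close> are independent,
  and the Taylor expansion of \<open>f\<close> is the product over \<open>v\<close> of the expansions of
  \<open>(1 - X)\<close> to the (possibly negative) power \<open>\<delta>\<^sub>v - 2\<close> at \<open>X = t\<^sup>E\<close>.  The coefficient at \<open>x\<close> thus collects
  all exponent vectors \<open>k\<close> with \<open>\<Sum>\<^sub>v k\<^sub>v E\<^sub>v\<^sup>* = x\<close>; there is at most one such \<open>k\<close>.
\<close>

definition z_coeff :: "'v::finite plumbing_graph \<Rightarrow> rat ^ 'v \<Rightarrow> rat" where
  "z_coeff \<Gamma> x =
     (\<Sum>k | (\<Sum>v\<in>UNIV. of_nat (k v) *s E_dual \<Gamma> v) = x.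
        \<Prod>v\<in>UNIV. fps_nth ((1 - fps_X) powi (int (valency \<Gamma> v) - 2)) (k v))"

text \<open>
  The infinite index set of the counting function is cut down to the support of \<open>z\<close>, because
  \<^const>\<open>sum\<close> over an infinite set is \<open>0\<close>.  The intended use is for \<open>x \<in> L'\<close> of class \<open>g\<close>
  and \<open>I \<noteq> {}\<close>.
\<close>

definition Q_count ::
  "'v::finite plumbing_graph \<Rightarrow> (rat ^ 'v) set \<Rightarrow> 'v set \<Rightarrow> rat ^ 'v \<Rightarrow> rat" where
  "Q_count \<Gamma> g I x =
     (\<Sum>l | l \<in> L_dual \<Gamma> \<and> \<not> (\<forall>v\<in>I. l $ v \<ge> x $ v) \<and> H_class \<Gamma> l = g \<and> z_coeff \<Gamma> l \<noteq> 0.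
        z_coeff \<Gamma> l)"


text \<open>
  A \<open>spin\<^sup>c\<close>-structure on the plumbed 4-manifold is identified with its first Chern class, a
  characteristic element of \<open>L'\<close>.  Two of them have the same restriction to the boundary iff
  they differ by an element of \<open>2L\<close>, so a \<open>spin\<^sup>c\<close>-structure on the boundary is a coset of \<open>2L\<close> in the
  characteristic elements.  The class of \<open>l'\<close> acts by adding \<open>2l'\<close> to Chern classes.
\<close>

definition characteristic_elements :: "'v::finite plumbing_graph \<Rightarrow> (rat ^ 'v) set" where
  "characteristic_elements \<Gamma> =
     {k \<in> L_dual \<Gamma>. \<forall>x\<in>L_lattice. \<exists>n::int. iform \<Gamma> k x + iform \<Gamma> x x = 2 * of_int n}"

definition spinc_restrict :: "rat ^ 'v::finite \<Rightarrow> (rat ^ 'v) set" where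
  "spinc_restrict k = {k + 2 *s x | x. x \<in> L_lattice}"

definition spinc :: "'v::finite plumbing_graph \<Rightarrow> (rat ^ 'v) set set" where
  "spinc \<Gamma> = spinc_restrict ` characteristic_elements \<Gamma>"

definition spinc_act :: "(rat ^ 'v::finite) set \<Rightarrow> (rat ^ 'v) set \<Rightarrow> (rat ^ 'v) set" where
  "spinc_act h \<sigma> = {k + 2 *s x | k x. k \<in> \<sigma> \<and> x \<in> h}"

definition sigma_can :: "'v::finite plumbing_graph \<Rightarrow> (rat ^ 'v) set" where
  "sigma_can \<Gamma> = spinc_restrict (Z_K \<Gamma>)"

text \<open>
  With \<open>K = - Z\<^sub>K\<close>, this is the number \<open>((K + 2x)\<^sup>2 + |V|) / 8\<close>.
\<close>

definition K_term :: "'v::finite plumbing_graph \<Rightarrow> rat ^ 'v \<Rightarrow> rat" where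
  "K_term \<Gamma> x =
     (iform \<Gamma> (- Z_K \<Gamma> + 2 *s x) (- Z_K \<Gamma> + 2 *s x) + of_nat CARD('v)) / 8"

text \<open>
  The Seiberg--Witten invariants of the plumbed 3-manifold enter as a function \<open>sw\<close> on its
  \<open>spin\<^sup>c\<close>-structures, that is, on \<^const>\<open>spinc\<close> (its values on other sets play no role).  The following is Nemethi's theorem for \<open>sw\<close>, which fixes the sign convention
  (and, as every class has representatives in the cone, determines all values of \<open>sw\<close>).
\<close>

definition nemethi_formula ::
  "'v::finite plumbing_graph \<Rightarrow> ((rat ^ 'v) set \<Rightarrow> rat) \<Rightarrow> bool" where
  "nemethi_formula \<Gamma> sw \<longleftrightarrow>
     (\<forall>a :: 'v \<Rightarrow> int. (\<forall>v. a v > 0) \<longrightarrow>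
        (let l = Z_K \<Gamma> + (\<Sum>v\<in>UNIV. of_int (a v) *s E_dual \<Gamma> v)
         in - Q_count \<Gamma> (H_class \<Gamma> l) UNIV l =
              K_term \<Gamma> l + sw (spinc_act (H_class \<Gamma> (- l)) (sigma_can \<Gamma>))))"

definition sw_norm ::
  "'v::finite plumbing_graph \<Rightarrow> ((rat ^ 'v) set \<Rightarrow> rat) \<Rightarrow> (rat ^ 'v) set \<Rightarrow> rat" where
  "sw_norm \<Gamma> sw h =
     sw (spinc_act (inv\<^bsub>H_group \<Gamma>\<^esub> h) (sigma_can \<Gamma>)) + K_term \<Gamma> (r_rep h)"

end

theory Submission
  imports Defs "HOL-Computational_Algebra.Formal_Laurent_Series"
begin

text \<open>
  Write \<open>l = r\<^sub>h + n\<close> with an integral labelling \<open>n\<close> of the vertices and \<open>k\<^sub>v = - (l, E\<^sub>v)\<close>.  The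
  coefficient of the series at \<open>l\<close> is the product over \<open>v\<close> of the coefficients of
  \<open>X\<close> to the power \<open>k\<^sub>v\<close> in \<open>(1 - X)\<close> to the power \<open>\<delta>\<^sub>v - 2\<close>, and \<open>k\<^sub>v\<close> depends only on the labels of \<open>v\<close> and
  of its neighbours.  A counting function is therefore a sum of products of local weights over the
  labellings of a tree, and the tree can be pruned: summing over the label of a leaf multiplies the
  series at the neighbour by \<open>(1 - X)\<close> times a Laurent series, and this product is a Laurent polynomial with
  value \<open>1\<close> at \<open>1\<close>; it also lowers the valency there by one (\<open>weight_prune_eq_sum\<close>, \<open>sum_prune\<close>).

  Two counts are compared: \<open>Q\<^sub>h(r\<^sub>h + X)\<close> for an \<open>X \<in> L\<close> deep in the cone, and the count at
  \<open>Z\<^sub>K - r\<^sub>h\<close> in the class \<open>[Z\<^sub>K] - h\<close>.  The reflection \<open>l \<mapsto> Z\<^sub>K - E - l\<close> replaces \<open>k\<^sub>v\<close> by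
  \<open>\<delta>\<^sub>v - 2 - k\<^sub>v\<close>, so the second count is the first one with every factor expanded at infinity, over the
  labellings with some \<open>n\<^sub>v \<ge> 0\<close> instead of some \<open>n\<^sub>v < X\<^sub>v\<close>.  Each pruning step removes from
  both counts a sum over the labels \<open>(i, j)\<close> of one edge, and the difference of these two sums is explicit
  (\<open>sum_partial_sum2_difference\<close>); the irregular part of it cancels against the
  contribution of the new factor to the vertex term of the neighbour.  What remains is a sum of vertex terms
  minus the products \<open>X\<^sub>uX\<^sub>v\<close> over the edges (\<open>counting_sum_duality\<close>), which for the given series is
  \<open>((K + 2r\<^sub>h)\<^sup>2 - (K + 2(r\<^sub>h + X))\<^sup>2) / 8\<close> (\<open>Q_count_duality\<close>).  Nemethi's theorem at \<open>r\<^sub>h + X\<close> turns this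
  into the assertion with all vertices in place of the nodes, and at \<open>Z\<^sub>K - r\<^sub>h\<close> the count over
  all vertices and the count over the nodes run over the same lattice points (\<open>Q_count_nodes\<close>).

  The removed sums involve only one edge because of a positivity property, \<open>confining\<close>: a labelling
  with \<open>k\<^sub>v \<le> \<delta>\<^sub>v - 2\<close> wherever it reaches the bound \<open>X\<close> does not reach it at all.  It follows from
  negative definiteness whenever \<open>r\<^sub>h + X\<close> lies, up to a vector with coordinates in \<open>[0, 1)\<close>, in the translate
  by \<open>Z\<^sub>K\<close> of the cone spanned by the dual vectors \<open>E\<^sub>v\<^sup>*\<close> (\<open>confining_monomials\<close>).  Points deep in the cone satisfy this, and
  so does \<open>Z\<^sub>K - r\<^sub>h\<close>, because \<open>r\<^sub>h\<close> itself has its coordinates in \<open>[0, 1)\<close>.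
  The property survives pruning (\<open>confining_prune\<close>).
\<close>

(* Both vectors and power series claim this symbol; it is used for vector components. *)
no_notation fps_nth (infixl "$" 75)
notation fls_nth (infixl "$$" 75)

section \<open>Laurent polynomials with value one at one\<close>

lemma convolution_indices_subset:
  fixes f g :: "rat fls"
  shows "{i. f $$ i \<noteq> 0 \<and> g $$ (k - i) \<noteq> 0} \<subseteq> {fls_subdegree f..k - fls_subdegree g}"
proof
  fix i assume "i \<in> {i. f $$ i \<noteq> 0 \<and> g $$ (k - i) \<noteq> 0}"
  then have "\<not> i < fls_subdegree f" and "\<not> k - i < fls_subdegree g"
    using fls_eq0_below_subdegree[of i f] fls_eq0_below_subdegree[of "k - i" g] by auto
  then show "i \<in> {fls_subdegree f..k - fls_subdegree g}" by simp
qed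

lemma fls_times_nth_finite_superset:
  fixes f g :: "rat fls"
  assumes "finite F" and "{i. f $$ i \<noteq> 0 \<and> g $$ (k - i) \<noteq> 0} \<subseteq> F"
  shows "(f * g) $$ k = (\<Sum>i\<in>F. f $$ i * g $$ (k - i))"
proof -
  let ?D = "{i. f $$ i \<noteq> 0 \<and> g $$ (k - i) \<noteq> 0}"
  have sub: "?D \<subseteq> {fls_subdegree f..k - fls_subdegree g}"
    by (rule convolution_indices_subset)
  have "(f * g) $$ k = (\<Sum>i\<in>?D. f $$ i * g $$ (k - i))"
    unfolding fls_times_nth(2)
    by (rule sum.mono_neutral_right) (use sub in auto)
  also have "\<dots> = (\<Sum>i\<in>F. f $$ i * g $$ (k - i))"
    by (rule sum.mono_neutral_left) (use assms in auto)
  finally show ?thesis .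
qed

lemma finite_convolution_indices:
  fixes f g :: "rat fls"
  shows "finite {i. f $$ i \<noteq> 0 \<and> g $$ (k - i) \<noteq> 0}"
by (rule finite_subset[OF convolution_indices_subset]) simp

lemma fls_times_nth_neq_0E:
  fixes f g :: "rat fls"
  assumes "(f * g) $$ k \<noteq> 0"
  obtains i where "f $$ i \<noteq> 0" and "g $$ (k - i) \<noteq> 0"
proof -
  have "(f * g) $$ k = (\<Sum>i\<in>{i. f $$ i \<noteq> 0 \<and> g $$ (k - i) \<noteq> 0}. f $$ i * g $$ (k - i))"
    by (rule fls_times_nth_finite_superset[OF finite_convolution_indices]) simp
  then show thesis
    using assms that by (metis (mono_tags, lifting) mem_Collect_eq sum.neutral)
qed

lemma fls_times_one_minus_X_nth:
  fixes f :: "rat fls"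
  shows "((1 - fls_X) * f) $$ k = f $$ k - f $$ (k - 1)"
  by (simp add: algebra_simps fls_X_times_conv_shift)

lemma one_minus_fls_X_neq_0: "(1 - fls_X :: rat fls) \<noteq> 0"
proof
  assume "(1 - fls_X :: rat fls) = 0"
  then have "(1 - fls_X :: rat fls) $$ 0 = 0 $$ 0" by metis
  then show False by simp
qed

definition finitely_supported :: "rat fls \<Rightarrow> bool" where
  "finitely_supported f \<longleftrightarrow> finite {k. f $$ k \<noteq> 0}"

definition coeff_sum :: "rat fls \<Rightarrow> rat" where
  "coeff_sum f = (\<Sum>k | f $$ k \<noteq> 0. f $$ k)"

definition partial_sum :: "rat fls \<Rightarrow> int \<Rightarrow> rat" where
  "partial_sum f k = (inverse (1 - fls_X) * f) $$ k"

text \<open>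
  A Laurent polynomial \<open>f\<close> has value \<open>1\<close> at \<open>1\<close> iff \<open>f = 1 + (1 - X) q\<close> for a Laurent polynomial \<open>q\<close>.
  Writing \<open>f\<close> in this form makes products transparent, and the sum of the coefficients of \<open>q\<close>
  is \<open>- f'(1)\<close>.
\<close>

definition excess :: "rat fls \<Rightarrow> rat fls" where
  "excess f = inverse (1 - fls_X) * (f - 1)"

definition normalized :: "rat fls \<Rightarrow> bool" where
  "normalized f \<longleftrightarrow> finitely_supported (excess f)"

lemma finitely_supported_add:
  "finitely_supported f \<Longrightarrow> finitely_supported g \<Longrightarrow> finitely_supported (f + g)"
  unfolding finitely_supported_def
  by (rule finite_subset[of _ "{k. f $$ k \<noteq> 0} \<union> {k. g $$ k \<noteq> 0}"]) auto

lemma finitely_supported_times: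
  assumes "finitely_supported f" and "finitely_supported g"
  shows "finitely_supported (f * g)"
proof -
  have "{k. (f * g) $$ k \<noteq> 0} \<subseteq> (\<lambda>(i, j). i + j) ` ({k. f $$ k \<noteq> 0} \<times> {k. g $$ k \<noteq> 0})"
  proof
    fix k assume "k \<in> {k. (f * g) $$ k \<noteq> 0}"
    then obtain i where "f $$ i \<noteq> 0" "g $$ (k - i) \<noteq> 0" using fls_times_nth_neq_0E by blast
    then show "k \<in> (\<lambda>(i, j). i + j) ` ({k. f $$ k \<noteq> 0} \<times> {k. g $$ k \<noteq> 0})"
      by (intro image_eqI[of _ _ "(i, k - i)"]) auto
  qed
  then show ?thesis
    using assms unfolding finitely_supported_def by (meson finite_SigmaI finite_imageI finite_subset)
qed

lemma finitely_supported_one_minus_X: "finitely_supported (1 - fls_X)"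
  unfolding finitely_supported_def
  by (rule finite_subset[of _ "{0, 1}"]) auto

lemma coeff_sum_superset:
  assumes "finite F" and "{k. f $$ k \<noteq> 0} \<subseteq> F"
  shows "coeff_sum f = (\<Sum>k\<in>F. f $$ k)"
  unfolding coeff_sum_def by (rule sum.mono_neutral_left) (use assms in auto)

lemma coeff_sum_add:
  assumes "finitely_supported f" and "finitely_supported g"
  shows "coeff_sum (f + g) = coeff_sum f + coeff_sum g"
proof -
  let ?F = "{k. f $$ k \<noteq> 0} \<union> {k. g $$ k \<noteq> 0}"
  have fin: "finite ?F" using assms by (simp add: finitely_supported_def)
  have "coeff_sum (f + g) = (\<Sum>k\<in>?F. (f + g) $$ k)" by (rule coeff_sum_superset[OF fin]) auto
  moreover have "coeff_sum f = (\<Sum>k\<in>?F. f $$ k)" by (rule coeff_sum_superset[OF fin]) auto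
  moreover have "coeff_sum g = (\<Sum>k\<in>?F. g $$ k)" by (rule coeff_sum_superset[OF fin]) auto
  ultimately show ?thesis by (simp add: sum.distrib)
qed

lemma coeff_sum_one_minus_X_times:
  assumes "finitely_supported f"
  shows "coeff_sum ((1 - fls_X) * f) = 0"
proof -
  let ?A = "{k. f $$ k \<noteq> 0}" and ?B = "(\<lambda>k. k + 1) ` {k. f $$ k \<noteq> 0}"
  have fin: "finite ?A" using assms by (simp add: finitely_supported_def)
  have mem: "k \<in> ?B \<longleftrightarrow> f $$ (k - 1) \<noteq> 0" for k by (auto intro!: image_eqI[of _ _ "k - 1"])
  have "coeff_sum ((1 - fls_X) * f) = (\<Sum>k\<in>?A \<union> ?B. f $$ k - f $$ (k - 1))"
    unfolding fls_times_one_minus_X_nth[symmetric]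
    by (rule coeff_sum_superset) (use fin mem in \<open>auto simp: fls_times_one_minus_X_nth\<close>)
  also have "\<dots> = (\<Sum>k\<in>?A \<union> ?B. f $$ k) - (\<Sum>k\<in>?A \<union> ?B. f $$ (k - 1))"
    by (simp add: sum_subtractf)
  also have "(\<Sum>k\<in>?A \<union> ?B. f $$ k) = (\<Sum>k\<in>?A. f $$ k)"
    by (rule sum.mono_neutral_right) (use fin in auto)
  also have "(\<Sum>k\<in>?A \<union> ?B. f $$ (k - 1)) = (\<Sum>k\<in>?B. f $$ (k - 1))"
    by (rule sum.mono_neutral_right) (use fin mem in auto)
  also have "\<dots> = (\<Sum>k\<in>?A. f $$ k)"
    by (subst sum.reindex) auto
  finally show ?thesis by simp
qed

lemma one_minus_X_inverse_cancel:
  "(1 - fls_X) * (inverse (1 - fls_X) * f) = (f :: rat fls)"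
  using one_minus_fls_X_neq_0 by (simp add: field_simps)

lemma eq_one_plus_excess: "f = 1 + (1 - fls_X) * excess f"
  unfolding excess_def by (simp add: one_minus_X_inverse_cancel)

lemma excess_one_plus: "excess (1 + (1 - fls_X) * q) = q"
  unfolding excess_def using one_minus_fls_X_neq_0 by (simp add: field_simps)

lemma excess_mult:
  "excess (f * g) = excess f + excess g + (1 - fls_X) * (excess f * excess g)"
proof -
  have "f * g = 1 + (1 - fls_X) * (excess f + excess g + (1 - fls_X) * (excess f * excess g))"
    by (subst (1) eq_one_plus_excess[of f], subst (1) eq_one_plus_excess[of g])
      (simp add: algebra_simps)
  then show ?thesis using excess_one_plus by metis
qed

lemma normalized_mult: "normalized f \<Longrightarrow> normalized g \<Longrightarrow> normalized (f * g)"
  unfolding normalized_def excess_mult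
  by (intro finitely_supported_add finitely_supported_times finitely_supported_one_minus_X)

text \<open>
  This is the Leibniz rule for \<open>f \<mapsto> - f'(1)\<close> at functions with value \<open>1\<close>.
\<close>

lemma coeff_sum_excess_mult:
  assumes "normalized f" and "normalized g"
  shows "coeff_sum (excess (f * g)) = coeff_sum (excess f) + coeff_sum (excess g)"
  using assms unfolding normalized_def excess_mult
  by (simp add: coeff_sum_add coeff_sum_one_minus_X_times finitely_supported_add
      finitely_supported_times finitely_supported_one_minus_X)

lemma partial_sum_diff: "partial_sum f k - partial_sum f (k - 1) = f $$ k"
  unfolding partial_sum_def fls_times_one_minus_X_nth[symmetric]
  by (simp add: one_minus_X_inverse_cancel)

lemma inverse_one_minus_fls_X: "inverse (1 - fls_X) = fps_to_fls (Abs_fps (\<lambda>n. 1 :: rat))"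
proof -
  have "(1 - fls_X) * fps_to_fls (Abs_fps (\<lambda>n. 1 :: rat)) = 1"
    by (intro fls_eqI) (simp add: fls_times_one_minus_X_nth)
  then show ?thesis
    by (metis inverse_unique)
qed

lemma inverse_one_minus_fls_X_nth: "inverse (1 - fls_X :: rat fls) $$ k = (if 0 \<le> k then 1 else 0)"
  by (simp add: inverse_one_minus_fls_X)

lemma excess_nth: "excess f $$ k = partial_sum f k - (if 0 \<le> k then 1 else 0)"
  by (simp add: excess_def partial_sum_def right_diff_distrib inverse_one_minus_fls_X_nth)

lemma normalized_iff:
  "normalized f \<longleftrightarrow> finite {k. partial_sum f k \<noteq> (if 0 \<le> k then 1 else 0)}"
  unfolding normalized_def finitely_supported_def excess_nth by simp

lemma partial_sum_below:
  obtains L where "\<And>k. k < L \<Longrightarrow> partial_sum f k = 0"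
  unfolding partial_sum_def by (meson fls_eq0_below_subdegree)

lemma finite_int_set_bounded:
  assumes "finite (A :: int set)"
  obtains M where "0 < M" and "\<And>k. k \<in> A \<Longrightarrow> - M < k \<and> k < M"
proof (cases "A = {}")
  case True
  then show thesis using that[of 1] by simp
next
  case False
  let ?M = "Max (abs ` A) + 1"
  have "\<bar>k\<bar> < ?M" if "k \<in> A" for k
    using Max_ge[of "abs ` A" "\<bar>k\<bar>"] assms that by simp
  then show thesis using that[of ?M] False
    by (smt (verit) ex_in_conv)
qed

text \<open>
  The partial sums are \<open>0\<close> far to the left and, since the coefficients add up to \<open>1\<close>, equal to \<open>1\<close>
  far to the right.
\<close>

lemma normalized_bound:
  assumes "normalized f"
  obtains M where "0 < M" and "\<And>k. M \<le> k \<Longrightarrow> partial_sum f k = 1"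
    and "\<And>k. k \<le> - M \<Longrightarrow> partial_sum f k = 0"
proof -
  obtain M where "0 < M"
    and M: "\<And>k. partial_sum f k \<noteq> (if 0 \<le> k then 1 else 0) \<Longrightarrow> - M < k \<and> k < M"
    using finite_int_set_bounded assms[unfolded normalized_iff] by (metis (mono_tags, lifting) mem_Collect_eq)
  show thesis
  proof (rule that[OF \<open>0 < M\<close>])
    show "partial_sum f k = 1" if "M \<le> k" for k
      using M[of k] that \<open>0 < M\<close> by (auto split: if_splits)
    show "partial_sum f k = 0" if "k \<le> - M" for k
      using M[of k] that \<open>0 < M\<close> by (auto split: if_splits)
  qed
qed

lemma partial_sum_eq_1:
  assumes "normalized f" and "\<And>m. k < m \<Longrightarrow> f $$ m = 0"
  shows "partial_sum f k = 1"
proof -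
  obtain M where M: "\<And>k. M \<le> k \<Longrightarrow> partial_sum f k = 1"
    using normalized_bound[OF assms(1)] by metis
  have "partial_sum f m = partial_sum f k" if "k \<le> m" for m
    using that
  proof (induction rule: int_ge_induct)
    case (step m)
    then show ?case using partial_sum_diff[of f "m + 1"] assms(2)[of "m + 1"] by simp
  qed simp
  from this[of "max k M"] M[of "max k M"] show ?thesis by simp
qed

text \<open>
  Summation by parts: \<open>1 - f'(1)\<close> is the sum of the partial sums at \<open>k \<le> 0\<close> minus the sum of
  their defects from the limit \<open>1\<close> at \<open>k > 0\<close>.  The index \<open>j = - k\<close> is used because \<open>j\<close> is going
  to be the label of a neighbour.
\<close>

lemma coeff_sum_excess_eq:
  assumes "0 < M" and "\<And>k. M \<le> k \<Longrightarrow> partial_sum f k = 1"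
    and "\<And>k. k \<le> - M \<Longrightarrow> partial_sum f k = 0"
  shows "1 + coeff_sum (excess f)
    = (\<Sum>j\<in>{0..M}. partial_sum f (- j)) - (\<Sum>j\<in>{-M..-1}. 1 - partial_sum f (- j))"
proof -
  have zero: "excess f $$ k = 0" if "k \<notin> {-M..M}" for k
    using assms(1) assms(2)[of k] assms(3)[of k] that by (auto simp: excess_nth)
  have "coeff_sum (excess f) = (\<Sum>k\<in>{-M..M}. excess f $$ k)"
    by (rule coeff_sum_superset) (use zero in blast)+
  also have "{-M..M} = {-M..0} \<union> {1..M}" using assms(1) by auto
  also have "(\<Sum>k\<in>{-M..0} \<union> {1..M}. excess f $$ k)
    = (\<Sum>k\<in>{-M..0}. excess f $$ k) + (\<Sum>k\<in>{1..M}. excess f $$ k)"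
    by (rule sum.union_disjoint) auto
  also have "(\<Sum>k\<in>{-M..0}. excess f $$ k)
    = (\<Sum>k\<in>{-M..0}. partial_sum f k - (if k = 0 then 1 else 0))"
    by (rule sum.cong) (auto simp: excess_nth)
  also have "\<dots> = (\<Sum>k\<in>{-M..0}. partial_sum f k) - 1"
    using assms(1) by (simp add: sum_subtractf)
  also have "(\<Sum>k\<in>{-M..0}. partial_sum f k) = (\<Sum>j\<in>{0..M}. partial_sum f (- j))"
    by (rule sum.reindex_bij_witness[of _ uminus uminus]) auto
  also have "(\<Sum>k\<in>{1..M}. excess f $$ k) = (\<Sum>k\<in>{1..M}. - (1 - partial_sum f k))"
    by (rule sum.cong) (auto simp: excess_nth)
  also have "\<dots> = - (\<Sum>j\<in>{-M..-1}. 1 - partial_sum f (- j))"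
    unfolding sum_negf neg_equal_iff_equal
    by (rule sum.reindex_bij_witness[of _ uminus uminus]) auto
  finally show ?thesis by simp
qed

text \<open>
  The relation says \<open>g(X) = X\<^sup>c f(1/X)\<close>; it transports expansions at infinity to expansions at \<open>0\<close>.
\<close>

definition reflected :: "int \<Rightarrow> rat fls \<Rightarrow> rat fls \<Rightarrow> bool" where
  "reflected c f g \<longleftrightarrow> (\<forall>k. g $$ k = f $$ (c - k))"

lemma reflected_mult:
  assumes "reflected c f f'" and "reflected d g g'"
  shows "reflected (c + d) (f * g) (f' * g')"
  unfolding reflected_def
proof
  fix k
  let ?I = "{i. f $$ i \<noteq> 0 \<and> g $$ (c + d - k - i) \<noteq> 0}"
  have "(f' * g') $$ k = (\<Sum>i\<in>(\<lambda>i. c - i) ` ?I. f' $$ i * g' $$ (k - i))"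
  proof (rule fls_times_nth_finite_superset)
    show "finite ((\<lambda>i. c - i) ` ?I)" by (intro finite_imageI finite_convolution_indices)
    show "{i. f' $$ i \<noteq> 0 \<and> g' $$ (k - i) \<noteq> 0} \<subseteq> (\<lambda>i. c - i) ` ?I"
    proof
      fix i assume "i \<in> {i. f' $$ i \<noteq> 0 \<and> g' $$ (k - i) \<noteq> 0}"
      then show "i \<in> (\<lambda>i. c - i) ` ?I"
        using assms unfolding reflected_def
        by (intro image_eqI[of _ _ "c - i"]) (auto simp: algebra_simps)
    qed
  qed
  also have "\<dots> = (\<Sum>i\<in>?I. f $$ i * g $$ (c + d - k - i))"
    using assms unfolding reflected_def
    by (subst sum.reindex) (auto simp: inj_on_def algebra_simps)
  also have "\<dots> = (f * g) $$ (c + d - k)"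
    by (rule fls_times_nth_finite_superset[OF finite_convolution_indices, symmetric]) simp
  finally show "(f' * g') $$ k = (f * g) $$ (c + d - k)" .
qed

text \<open>
  A partial sum of \<open>g\<close> is a tail sum of \<open>f\<close>, and all coefficients of \<open>f\<close> add up to \<open>1\<close>.
\<close>

lemma partial_sum_reflected:
  assumes "normalized f" and "reflected c f g"
  shows "partial_sum g k = 1 - partial_sum f (c - 1 - k)"
proof -
  obtain M where M: "\<And>k. M \<le> k \<Longrightarrow> partial_sum f k = 1"
    using normalized_bound[OF assms(1)] by metis
  obtain L where L: "\<And>k. k < L \<Longrightarrow> partial_sum g k = 0" using partial_sum_below by metis
  (* The sum h is constant, and it is 1 far to the left. *)
  define h where "h k = partial_sum g k + partial_sum f (c - 1 - k)" for k
  have step: "h k = h (k - 1)" for k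
  proof -
    have "g $$ k = f $$ (c - k)" using assms(2) by (simp add: reflected_def)
    then show ?thesis
      using partial_sum_diff[of g k] partial_sum_diff[of f "c - k"]
      by (simp add: h_def algebra_simps)
  qed
  have "h m = h k" if "m \<le> k" for m
    using that
  proof (induction rule: int_le_induct)
    case (step m)
    then show ?case using \<open>\<And>k. h k = h (k - 1)\<close>[of m] by simp
  qed simp
  from this[of "min k (min (L - 1) (c - 1 - M))"] have "h k = 1"
    using L[of "min k (min (L - 1) (c - 1 - M))"] M[of "c - 1 - min k (min (L - 1) (c - 1 - M))"]
    by (simp add: h_def)
  then show ?thesis by (simp add: h_def)
qed

lemma partial_sum_eq_sum:
  assumes "\<And>k. k < L \<Longrightarrow> f $$ k = 0"
  shows "partial_sum f K = (\<Sum>k\<in>{L..K}. f $$ k)"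
proof -
  obtain L' where L': "\<And>k. k < L' \<Longrightarrow> partial_sum f k = 0" using partial_sum_below by metis
  define M where "M = min K (min L L') - 1"
  have "partial_sum f K = (\<Sum>k\<in>{M..K}. f $$ k)"
  proof -
    have "M \<le> K" by (simp add: M_def)
    then show ?thesis
    proof (induction rule: int_ge_induct)
      case base
      show ?case using partial_sum_diff[of f M] L'[of "M - 1"] by (simp add: M_def)
    next
      case (step k)
      have "{M..k + 1} = insert (k + 1) {M..k}" using step.hyps by auto
      then show ?case using step.IH partial_sum_diff[of f "k + 1"] by simp
    qed
  qed
  also have "\<dots> = (\<Sum>k\<in>{L..K}. f $$ k)"
    by (rule sum.mono_neutral_right) (use assms in \<open>auto simp: M_def\<close>)
  finally show ?thesis .
qed

text \<open>
  These are the coefficients of \<open>f / (1 - X)\<^sup>2\<close>.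
\<close>

definition partial_sum2 :: "rat fls \<Rightarrow> int \<Rightarrow> rat" where
  "partial_sum2 f k = partial_sum (inverse (1 - fls_X) * f) k"

lemma partial_sum2_eq_sum:
  assumes "\<And>k. k < L \<Longrightarrow> partial_sum f k = 0"
  shows "partial_sum2 f K = (\<Sum>k\<in>{L..K}. partial_sum f k)"
  unfolding partial_sum2_def using assms unfolding partial_sum_def[of f]
  by (rule partial_sum_eq_sum)

text \<open>
  For \<open>V = 0\<close> the two terms on the left are the coefficients at \<open>0\<close> of the expansions of
  \<open>f / (1 - X)\<^sup>2\<close> at \<open>0\<close> and at infinity.  Their difference is a residue at \<open>1\<close>, so it depends only on
  \<open>f(1) = 1\<close> and \<open>f'(1)\<close>.  Moving to \<open>V\<close> omits \<open>V\<close> partial sums.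
\<close>

lemma partial_sum2_difference:
  assumes f: "normalized f" and g: "reflected 2 f g" and "0 \<le> V"
  shows "partial_sum2 f (- V) - partial_sum2 g 0
    = 1 + coeff_sum (excess f) - (\<Sum>j\<in>{0..<V}. partial_sum f (- j))"
proof -
  obtain M0 where M0: "0 < M0" "\<And>k. M0 \<le> k \<Longrightarrow> partial_sum f k = 1"
    "\<And>k. k \<le> - M0 \<Longrightarrow> partial_sum f k = 0"
    using normalized_bound[OF f] by metis
  define M where "M = max M0 V"
  have M: "0 < M" "\<And>k. M \<le> k \<Longrightarrow> partial_sum f k = 1" "\<And>k. k \<le> - M \<Longrightarrow> partial_sum f k = 0" "V \<le> M"
    using M0 by (auto simp: M_def)
  have "partial_sum2 f (- V) = (\<Sum>k\<in>{-M..-V}. partial_sum f k)"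
    by (rule partial_sum2_eq_sum) (use M(3) in simp)
  also have "\<dots> = (\<Sum>j\<in>{V..M}. partial_sum f (- j))"
    by (rule sum.reindex_bij_witness[of _ uminus uminus]) auto
  finally have 1: "partial_sum2 f (- V) = (\<Sum>j\<in>{V..M}. partial_sum f (- j))" .
  have gk: "partial_sum g k = 1 - partial_sum f (1 - k)" for k
    using partial_sum_reflected[OF f g, of k] by simp
  have "partial_sum2 g 0 = (\<Sum>k\<in>{1-M..0}. partial_sum g k)"
    by (rule partial_sum2_eq_sum) (simp add: gk M(2))
  also have "\<dots> = (\<Sum>j\<in>{-M..-1}. 1 - partial_sum f (- j))"
    by (rule sum.reindex_bij_witness[of _ "\<lambda>j. j + 1" "\<lambda>k. k - 1"]) (auto simp: gk)
  finally have 2: "partial_sum2 g 0 = (\<Sum>j\<in>{-M..-1}. 1 - partial_sum f (- j))" .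
  have "{0..M} = {0..<V} \<union> {V..M}" using M(4) \<open>0 \<le> V\<close> by auto
  then have "(\<Sum>j\<in>{0..M}. partial_sum f (- j))
    = (\<Sum>j\<in>{0..<V}. partial_sum f (- j)) + (\<Sum>j\<in>{V..M}. partial_sum f (- j))"
    by (simp only:) (rule sum.union_disjoint; auto)
  with 1 2 coeff_sum_excess_eq[OF M(1-3)] show ?thesis by simp
qed

text \<open>
  Here \<open>f i\<close> is the series at a leaf with label \<open>i\<close>, and \<open>partial_sum (f i) (- j)\<close> is the weight of that
  leaf when its neighbour has label \<open>j\<close>.  The two sums are what the removal of the leaf takes away from
  the two counts.  The hypotheses on saturation and vanishing confine both sums to \<open>0 \<le> i < U\<close>, where
  they can be compared term by term.
\<close>

lemma sum_partial_sum2_difference: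
  fixes f g :: "int \<Rightarrow> rat fls"
  assumes f: "\<And>i. normalized (f i)" and g: "\<And>i. reflected 2 (f i) (g (- 1 - i))"
    and "0 \<le> U" "0 \<le> V"
    and sat: "\<And>i j. U \<le> i \<Longrightarrow> j < V \<Longrightarrow> partial_sum (f i) (- j) = 1"
    and vanish: "\<And>i j. i < 0 \<Longrightarrow> 0 \<le> j \<Longrightarrow> partial_sum (f i) (- j) = 0"
    and "L \<le> 0" "L' \<le> - U"
  shows "(\<Sum>i\<in>{L..<U}. partial_sum2 (f i) (- V)) - (\<Sum>i\<in>{L'..<0}. partial_sum2 (g i) 0)
    = (\<Sum>i\<in>{0..<U}. 1 + coeff_sum (excess (f i))) - (\<Sum>i\<in>{0..<U}. \<Sum>j\<in>{0..<V}. partial_sum (f i) (- j))"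
proof -
  have z1: "partial_sum2 (f i) (- V) = 0" if "i < 0" for i
  proof -
    obtain L1 where L1: "\<And>k. k < L1 \<Longrightarrow> partial_sum (f i) k = 0" using partial_sum_below by metis
    have "partial_sum2 (f i) (- V) = (\<Sum>k\<in>{L1..-V}. partial_sum (f i) k)"
      by (rule partial_sum2_eq_sum[OF L1])
    also have "\<dots> = 0" using vanish[OF that, of "- k" for k] \<open>0 \<le> V\<close> by (intro sum.neutral) force
    finally show ?thesis .
  qed
  have z2: "partial_sum2 (g (- 1 - i)) 0 = 0" if "U \<le> i" for i
  proof -
    have gk: "partial_sum (g (- 1 - i)) k = 1 - partial_sum (f i) (1 - k)" for k
      using partial_sum_reflected[OF f g, of i k] by simp
    obtain L1 where L1: "\<And>k. k < L1 \<Longrightarrow> partial_sum (g (- 1 - i)) k = 0" using partial_sum_below by metis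
    have "partial_sum2 (g (- 1 - i)) 0 = (\<Sum>k\<in>{L1..0}. partial_sum (g (- 1 - i)) k)"
      by (rule partial_sum2_eq_sum[OF L1])
    also have "\<dots> = 0"
    proof (intro sum.neutral ballI)
      fix k assume "k \<in> {L1..0}"
      then show "partial_sum (g (- 1 - i)) k = 0" using sat[OF that, of "k - 1"] \<open>0 \<le> V\<close> gk by simp
    qed
    finally show ?thesis .
  qed
  have "(\<Sum>i\<in>{L..<U}. partial_sum2 (f i) (- V)) = (\<Sum>i\<in>{0..<U}. partial_sum2 (f i) (- V))"
    by (rule sum.mono_neutral_right) (use z1 \<open>L \<le> 0\<close> in auto)
  moreover have "(\<Sum>i\<in>{L'..<0}. partial_sum2 (g i) 0) = (\<Sum>i\<in>{0..<- L'}. partial_sum2 (g (- 1 - i)) 0)"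
    by (rule sum.reindex_bij_witness[of _ "\<lambda>i. - 1 - i" "\<lambda>i. - 1 - i"]) auto
  moreover have "\<dots> = (\<Sum>i\<in>{0..<U}. partial_sum2 (g (- 1 - i)) 0)"
    by (rule sum.mono_neutral_right) (use z2 \<open>L' \<le> - U\<close> in auto)
  ultimately show ?thesis
    using partial_sum2_difference[OF f g \<open>0 \<le> V\<close>] by (simp add: sum_subtractf[symmetric])
qed

lemma partial_sum_monomial: "partial_sum (fls_shift (- m) 1) k = (if m \<le> k then 1 else 0)"
proof -
  have "inverse (1 - fls_X) * fls_shift (- m) 1 = fls_shift (- m) (inverse (1 - fls_X) :: rat fls)"
    by (simp add: fls_X_intpow_times_conv_shift)
  then show ?thesis by (simp add: partial_sum_def inverse_one_minus_fls_X_nth)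
qed

lemma normalized_monomial: "normalized (fls_shift (- m) 1)"
  unfolding normalized_iff partial_sum_monomial
proof (rule finite_subset)
  show "{k. (if m \<le> k then 1 else 0 :: rat) \<noteq> (if 0 \<le> k then 1 else 0)} \<subseteq> {min m 0..max m 0}"
    by (auto split: if_splits)
qed simp

lemma coeff_sum_excess_monomial: "coeff_sum (excess (fls_shift (- m) 1)) = - of_int m"
proof -
  have e: "excess (fls_shift (- m) 1) $$ k = (if m \<le> k then 1 else 0) - (if 0 \<le> k then 1 else 0)" for k
    by (simp add: excess_nth partial_sum_monomial)
  show ?thesis
  proof (cases "0 \<le> m")
    case True
    have "coeff_sum (excess (fls_shift (- m) 1)) = (\<Sum>k\<in>{0..<m}. excess (fls_shift (- m) 1) $$ k)"
      by (rule coeff_sum_superset) (use True in \<open>auto simp: e split: if_splits\<close>)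
    also have "\<dots> = (\<Sum>k\<in>{0..<m}. - 1)" by (rule sum.cong) (auto simp: e)
    finally show ?thesis using True by simp
  next
    case False
    have "coeff_sum (excess (fls_shift (- m) 1)) = (\<Sum>k\<in>{m..<0}. excess (fls_shift (- m) 1) $$ k)"
      by (rule coeff_sum_superset) (use False in \<open>auto simp: e split: if_splits\<close>)
    also have "\<dots> = (\<Sum>k\<in>{m..<0}. 1)" by (rule sum.cong) (auto simp: e)
    finally show ?thesis using False by simp
  qed
qed

text \<open>
  In the Laurent series the coefficients at negative exponents vanish, so that the integral exponents
  \<open>k\<^sub>v\<close> need no sign condition.
\<close>

lemma one_minus_fls_X_powi_nth:
  "((1 - fls_X :: rat fls) powi m) $$ k = (if 0 \<le> k then fps_nth ((1 - fps_X) powi m) (nat k) else 0)"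
proof -
  have X: "fps_to_fls (1 - fps_X) = (1 - fls_X :: rat fls)" by (simp add: fls_eq_iff)
  have inv: "fps_to_fls (inverse (1 - fps_X :: rat fps)) = inverse (1 - fls_X)"
    unfolding X[symmetric] by (rule fls_inverse_fps_to_fls[symmetric]) (simp add: subdegree_eq_0)
  have "fps_to_fls ((1 - fps_X) powi m) = (1 - fls_X :: rat fls) powi m"
    by (cases "0 \<le> m") (simp_all add: power_int_def fps_to_fls_power X inv)
  then show ?thesis by (simp flip: \<open>fps_to_fls ((1 - fps_X) powi m) = (1 - fls_X :: rat fls) powi m\<close>)
qed

section \<open>Weighted labellings and the removal of leaves\<close>

locale finite_graph =
  fixes adj :: "'v::finite \<Rightarrow> 'v \<Rightarrow> bool"
  assumes adj_sym: "adj v w \<Longrightarrow> adj w v"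
    and adj_irrefl: "\<not> adj v v"
begin

definition neighbours :: "'v set \<Rightarrow> 'v \<Rightarrow> 'v set" where
  "neighbours S w = {x \<in> S. adj w x}"

definition neighbour_sum :: "'v set \<Rightarrow> ('v \<Rightarrow> int) \<Rightarrow> 'v \<Rightarrow> int" where
  "neighbour_sum S n w = (\<Sum>x\<in>neighbours S w. n x)"

definition vertex_series :: "'v set \<Rightarrow> 'v \<Rightarrow> rat fls \<Rightarrow> rat fls" where
  "vertex_series S w f = (1 - fls_X) powi (int (card (neighbours S w)) - 2) * f"

text \<open>
  The data \<open>\<Psi> w j\<close> describe the vertex \<open>w\<close> with label \<open>j\<close>.  The exponent at which the vertex series is
  evaluated should be \<open>k\<^sub>w = - (l, E\<^sub>w)\<close>; its part depending on \<open>n w\<close> is absorbed into \<open>\<Psi> w (n w)\<close>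
  as a shift, so only the labels of the neighbours remain.
\<close>

definition weight :: "'v set \<Rightarrow> ('v \<Rightarrow> int \<Rightarrow> rat fls) \<Rightarrow> ('v \<Rightarrow> int) \<Rightarrow> rat" where
  "weight S \<Psi> n = (\<Prod>w\<in>S. vertex_series S w (\<Psi> w (n w)) $$ (- neighbour_sum S n w))"

text \<open>
  Labels outside \<open>S\<close> are set to \<open>0\<close> in order that each labelling of \<open>S\<close> is represented once.
\<close>

definition support :: "'v set \<Rightarrow> ('v \<Rightarrow> int \<Rightarrow> rat fls) \<Rightarrow> ('v \<Rightarrow> int) set" where
  "support S \<Psi> = {n. (\<forall>w. w \<notin> S \<longrightarrow> n w = 0) \<and> weight S \<Psi> n \<noteq> 0}"

definition pendant :: "'v set \<Rightarrow> 'v \<Rightarrow> 'v \<Rightarrow> bool" where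
  "pendant S u v \<longleftrightarrow> u \<notin> S \<and> neighbours S u = {v}"

text \<open>
  A tree is a set obtained from a root by adding pendant vertices, so that rule induction
  removes leaves.
\<close>

inductive subtree :: "'v \<Rightarrow> 'v set \<Rightarrow> bool" for r where
  root: "subtree r {r}"
| grow: "subtree r S \<Longrightarrow> pendant S u v \<Longrightarrow> subtree r (insert u S)"

lemma pendant_neighbours:
  assumes "pendant S u v"
  shows "u \<notin> S" "v \<in> S" "u \<noteq> v" "neighbours (insert u S) u = {v}" "neighbours (insert u S) v = insert u (neighbours S v)"
    "u \<notin> neighbours S v" "w \<in> S \<Longrightarrow> w \<noteq> v \<Longrightarrow> neighbours (insert u S) w = neighbours S w"
proof -
  show u: "u \<notin> S" and v: "v \<in> S" using assms by (auto simp: pendant_def neighbours_def)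
  show "u \<noteq> v" using u v by auto
  show "neighbours (insert u S) u = {v}" using assms adj_irrefl by (auto simp: pendant_def neighbours_def)
  have uv: "adj u v" using assms by (auto simp: pendant_def neighbours_def)
  show "neighbours (insert u S) v = insert u (neighbours S v)" using adj_sym[OF uv] by (auto simp: neighbours_def)
  show "u \<notin> neighbours S v" using u by (auto simp: neighbours_def)
  show "neighbours (insert u S) w = neighbours S w" if "w \<in> S" "w \<noteq> v"
    using assms that adj_sym[of w u] by (auto simp: pendant_def neighbours_def)
qed

lemma pendant_neighbour_sum:
  assumes "pendant S u v"
  shows "neighbour_sum (insert u S) n u = n v"
    "neighbour_sum (insert u S) (n(u := i)) v = neighbour_sum S n v + i"
    "w \<in> S \<Longrightarrow> w \<noteq> v \<Longrightarrow> neighbour_sum (insert u S) (n(u := i)) w = neighbour_sum S n w"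
proof -
  note nb = pendant_neighbours[OF assms]
  show "neighbour_sum (insert u S) n u = n v" using nb by (simp add: neighbour_sum_def)
  have eq: "(\<Sum>x\<in>neighbours S w. (n(u := i)) x) = (\<Sum>x\<in>neighbours S w. n x)" for w
    using nb(1) by (intro sum.cong) (auto simp: neighbours_def)
  show "neighbour_sum (insert u S) (n(u := i)) v = neighbour_sum S n v + i"
    using nb eq[of v] unfolding neighbour_sum_def by simp
  show "neighbour_sum (insert u S) (n(u := i)) w = neighbour_sum S n w" if "w \<in> S" "w \<noteq> v"
    using nb(7)[OF that] eq[of w] unfolding neighbour_sum_def by simp
qed

lemma subtree_insert_root:
  assumes "subtree s S" and "pendant S u s"
  shows "subtree u (insert u S)"
  using assms
proof (induction rule: subtree.induct)
  case root
  have "pendant {u} s u"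
    using root pendant_neighbours(1,3)[OF root] adj_sym unfolding pendant_def neighbours_def by auto
  from subtree.grow[OF subtree.root this] show ?case by (simp add: insert_commute)
next
  case (grow S x y)
  have s: "s \<in> S" using grow.hyps(1) by (induction rule: subtree.induct) auto
  have x: "x \<notin> S" using grow.hyps(2) by (simp add: pendant_def)
  have u: "u \<notin> insert x S" and us: "neighbours (insert x S) u = {s}"
    using grow.prems by (simp_all add: pendant_def)
  have "neighbours S u = {s}" using us s x by (auto simp: neighbours_def)
  then have "subtree u (insert u S)" using grow.IH u by (simp add: pendant_def)
  moreover have "\<not> adj u x" using us s x by (auto simp: neighbours_def)
  then have "pendant (insert u S) x y"
    using grow.hyps(2) u adj_sym unfolding pendant_def neighbours_def by auto
  ultimately have "subtree u (insert x (insert u S))" by (rule subtree.grow)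
  then show ?case by (simp add: insert_commute)
qed

text \<open>
  Leaves are removed in an order that keeps a prescribed vertex to the end.  A truncated sum below has to be
  evaluated with the newest leaf in that role, so the root must be free to move.
\<close>

lemma subtree_reroot:
  assumes "subtree r S" and "s \<in> S"
  shows "subtree s S"
  using assms
proof (induction arbitrary: s rule: subtree.induct)
  case root
  then show ?case by (auto intro: subtree.root)
next
  case (grow S u v)
  show ?case
  proof (cases "s = u")
    case True
    have "subtree v S" using grow.IH pendant_neighbours(2)[OF grow.hyps(2)] by blast
    then show ?thesis using subtree_insert_root grow.hyps(2) True by blast
  next
    case False
    then show ?thesis using grow by (auto intro: subtree.grow)
  qed
qed

text \<open>
  The coefficient at \<open>i\<close> is the weight of a leaf with label \<open>i \<in> B\<close> whose neighbour has label \<open>j\<close>.  The set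
  \<open>B\<close> is everything when the leaf is summed out, and a half-line when only labels above a
  bound are allowed.
\<close>

definition branch_series :: "(int \<Rightarrow> rat fls) \<Rightarrow> int set \<Rightarrow> int \<Rightarrow> rat fls" where
  "branch_series f B j = Abs_fls (\<lambda>i. if i \<in> B then partial_sum (f i) (- j) else 0)"

text \<open>
  This is what makes \<open>branch_series\<close> a Laurent series and the factor \<open>branch_factor\<close> below a Laurent
  polynomial with value \<open>1\<close> at \<open>1\<close>.
\<close>

definition prunable :: "(int \<Rightarrow> rat fls) \<Rightarrow> int set \<Rightarrow> bool" where
  "prunable f B \<longleftrightarrow>
     (\<forall>j. finite {i. (if i \<in> B then partial_sum (f i) (- j) else 0) \<noteq> (if 0 \<le> i then 1 else 0)})"

definition branch_factor :: "(int \<Rightarrow> rat fls) \<Rightarrow> int set \<Rightarrow> int \<Rightarrow> rat fls" where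
  "branch_factor f B j = (1 - fls_X) * branch_series f B j"

definition prune :: "'v \<Rightarrow> 'v \<Rightarrow> int set \<Rightarrow> ('v \<Rightarrow> int \<Rightarrow> rat fls) \<Rightarrow> 'v \<Rightarrow> int \<Rightarrow> rat fls" where
  "prune v u B \<Psi> = \<Psi>(v := \<lambda>j. \<Psi> v j * branch_factor (\<Psi> u) B j)"

lemma branch_series_nth:
  assumes "prunable f B"
  shows "branch_series f B j $$ i = (if i \<in> B then partial_sum (f i) (- j) else 0)"
proof -
  obtain M where "0 < M" and M: "\<And>i. (if i \<in> B then partial_sum (f i) (- j) else 0) \<noteq> (if 0 \<le> i then 1 else 0)
      \<Longrightarrow> - M < i \<and> i < M"
    using finite_int_set_bounded assms[unfolded prunable_def, rule_format, of j]
    by (metis (mono_tags, lifting) mem_Collect_eq)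
  have "(if i \<in> B then partial_sum (f i) (- j) else 0) = 0" if "i < - M" for i
  proof (rule ccontr)
    assume "(if i \<in> B then partial_sum (f i) (- j) else 0) \<noteq> 0"
    moreover have "\<not> 0 \<le> i" using that \<open>0 < M\<close> by linarith
    ultimately have "- M < i" using M[of i] by argo
    then show False using that by linarith
  qed
  then show ?thesis
    unfolding branch_series_def by (subst nth_Abs_fls_lower_bound[of "- M"]) blast+
qed

lemma partial_sum_branch_factor:
  "partial_sum (branch_factor f B j) i = branch_series f B j $$ i"
proof -
  have "inverse (1 - fls_X) * ((1 - fls_X) * branch_series f B j) = branch_series f B j"
    unfolding mult.assoc[symmetric] left_inverse[OF one_minus_fls_X_neq_0] by simp
  then show ?thesis unfolding partial_sum_def branch_factor_def by (simp only:)
qed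

lemma normalized_branch_factor: "prunable f B \<Longrightarrow> normalized (branch_factor f B j)"
  unfolding normalized_iff partial_sum_branch_factor
  by (simp add: branch_series_nth prunable_def)

text \<open>
  The removal of a leaf lowers the valency of its neighbour, which costs one factor \<open>1 - X\<close>; this is the factor
  that turns the branch series into a Laurent polynomial.
\<close>

lemma vertex_series_pendant:
  assumes "pendant S u v"
  shows "vertex_series (insert u S) v f * branch_series g B j = vertex_series S v (f * branch_factor g B j)"
proof -
  have eq: "int (card (neighbours (insert u S) v)) - 2 = (int (card (neighbours S v)) - 2) + 1"
    using pendant_neighbours[OF assms] by simp
  have "(1 - fls_X :: rat fls) powi (int (card (neighbours (insert u S) v)) - 2)
    = (1 - fls_X) powi (int (card (neighbours S v)) - 2) * (1 - fls_X)"
    unfolding eq by (intro power_int_add_1 disjI1 one_minus_fls_X_neq_0)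
  then show ?thesis
    unfolding vertex_series_def branch_factor_def by (simp only: mult_ac)
qed

lemma weight_insert:
  assumes "pendant S u v"
  shows "weight (insert u S) \<Psi> (n(u := i))
    = partial_sum (\<Psi> u i) (- n v) * vertex_series (insert u S) v (\<Psi> v (n v)) $$ (- neighbour_sum S n v - i)
      * (\<Prod>w\<in>S - {v}. vertex_series S w (\<Psi> w (n w)) $$ (- neighbour_sum S n w))"
proof -
  note nb = pendant_neighbours[OF assms] and nbs = pendant_neighbour_sum[OF assms]
  let ?n = "n(u := i)" and ?S = "insert u S"
  let ?F = "\<lambda>w. vertex_series ?S w (\<Psi> w (?n w)) $$ (- neighbour_sum ?S ?n w)"
  have "weight ?S \<Psi> ?n = ?F u * ?F v * (\<Prod>w\<in>S - {v}. ?F w)"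
    unfolding weight_def using nb(1,2) by (simp add: prod.remove[of S v])
  moreover have "?F u = partial_sum (\<Psi> u i) (- n v)"
    using nb nbs(1)[of ?n] by (simp add: vertex_series_def partial_sum_def power_int_minus)
  moreover have "?F v = vertex_series ?S v (\<Psi> v (n v)) $$ (- neighbour_sum S n v - i)"
    using nb(3) nbs(2) by simp
  moreover have "(\<Prod>w\<in>S - {v}. ?F w) = (\<Prod>w\<in>S - {v}. vertex_series S w (\<Psi> w (n w)) $$ (- neighbour_sum S n w))"
    by (rule prod.cong) (use nb nbs(3) in \<open>auto simp: vertex_series_def\<close>)
  ultimately show ?thesis by simp
qed

text \<open>
  The label of the leaf shifts the exponent at its neighbour, so summing over it is the Cauchy product
  of the branch series and the vertex series of the neighbour.
\<close>

lemma weight_prune_eq_sum: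
  fixes n :: "'v \<Rightarrow> int"
  assumes pend: "pendant S u v" and pr: "prunable (\<Psi> u) B"
  defines "F \<equiv> {i \<in> B. weight (insert u S) \<Psi> (n(u := i)) \<noteq> 0}"
  shows "finite F"
    and "weight S (prune v u B \<Psi>) n = (\<Sum>i\<in>F. weight (insert u S) \<Psi> (n(u := i)))"
proof -
  let ?\<Phi> = "vertex_series (insert u S) v (\<Psi> v (n v))"
  let ?G = "branch_series (\<Psi> u) B (n v)"
  let ?k = "- neighbour_sum S n v"
  let ?R = "\<Prod>w\<in>S - {v}. vertex_series S w (\<Psi> w (n w)) $$ (- neighbour_sum S n w)"
  let ?I = "{i. ?G $$ i \<noteq> 0 \<and> ?\<Phi> $$ (?k - i) \<noteq> 0}"
  note wi = weight_insert[OF pend, of \<Psi> n]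
  (* The inclusion can be strict if another factor of the weight vanishes; both sides are 0 then. *)
  have FI: "F \<subseteq> ?I" unfolding F_def wi by (auto simp: branch_series_nth[OF pr])
  then show "finite F" using finite_convolution_indices finite_subset by blast
  have "weight S (prune v u B \<Psi>) n
    = vertex_series S v (\<Psi> v (n v) * branch_factor (\<Psi> u) B (n v)) $$ ?k * ?R"
  proof -
    have "weight S (prune v u B \<Psi>) n = vertex_series S v (prune v u B \<Psi> v (n v)) $$ ?k
      * (\<Prod>w\<in>S - {v}. vertex_series S w (prune v u B \<Psi> w (n w)) $$ (- neighbour_sum S n w))"
      unfolding weight_def using pendant_neighbours(2)[OF pend] by (simp add: prod.remove[of S v])
    moreover have "(\<Prod>w\<in>S - {v}. vertex_series S w (prune v u B \<Psi> w (n w)) $$ (- neighbour_sum S n w)) = ?R"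
      by (rule prod.cong) (auto simp: prune_def)
    ultimately show ?thesis by (simp add: prune_def)
  qed
  also have "\<dots> = (?G * ?\<Phi>) $$ ?k * ?R"
    by (simp add: vertex_series_pendant[OF pend, symmetric] mult.commute)
  also have "\<dots> = (\<Sum>i\<in>?I. ?G $$ i * ?\<Phi> $$ (?k - i) * ?R)"
    by (subst fls_times_nth_finite_superset[OF finite_convolution_indices order_refl])
      (simp add: sum_distrib_right)
  also have "\<dots> = (\<Sum>i\<in>F. ?G $$ i * ?\<Phi> $$ (?k - i) * ?R)"
    by (rule sum.mono_neutral_right[OF finite_convolution_indices FI])
      (auto simp: F_def wi branch_series_nth[OF pr] split: if_splits)
  also have "\<dots> = (\<Sum>i\<in>F. weight (insert u S) \<Psi> (n(u := i)))"
    by (rule sum.cong) (auto simp: F_def wi branch_series_nth[OF pr])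
  finally show "weight S (prune v u B \<Psi>) n = (\<Sum>i\<in>F. weight (insert u S) \<Psi> (n(u := i)))" .
qed

lemma sum_prune:
  assumes pend: "pendant S u v" and pr: "prunable (\<Psi> u) B"
    and P: "\<And>n i. P (n(u := i)) \<longleftrightarrow> P n"
    and fin: "finite {n \<in> support (insert u S) \<Psi>. P n \<and> n u \<in> B}"
  shows "finite {n \<in> support S (prune v u B \<Psi>). P n}"
    and "(\<Sum>n | n \<in> support (insert u S) \<Psi> \<and> P n \<and> n u \<in> B. weight (insert u S) \<Psi> n)
       = (\<Sum>n | n \<in> support S (prune v u B \<Psi>) \<and> P n. weight S (prune v u B \<Psi>) n)"
proof -
  let ?A = "{n \<in> support (insert u S) \<Psi>. P n \<and> n u \<in> B}"
  let ?\<pi> = "\<lambda>n. n(u := 0 :: int)"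
  let ?D = "{n \<in> support S (prune v u B \<Psi>). P n}"
  note u = pendant_neighbours(1)[OF pend]
  note wp = weight_prune_eq_sum[of S u v \<Psi> B, OF pend pr]
  have sub: "?D \<subseteq> ?\<pi> ` ?A"
  proof
    fix n assume n: "n \<in> ?D"
    then have "weight S (prune v u B \<Psi>) n \<noteq> 0" by (simp add: support_def)
    then have "(\<Sum>i\<in>{i \<in> B. weight (insert u S) \<Psi> (n(u := i)) \<noteq> 0}. weight (insert u S) \<Psi> (n(u := i))) \<noteq> 0"
      unfolding wp(2) .
    then obtain i where i: "i \<in> B" "weight (insert u S) \<Psi> (n(u := i)) \<noteq> 0"
      by (elim sum.not_neutral_contains_not_neutral) blast
    have "n u = 0" using n u by (auto simp: support_def)
    then have "n = ?\<pi> (n(u := i))" by auto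
    moreover have "n(u := i) \<in> ?A" using n i P by (auto simp: support_def)
    ultimately show "n \<in> ?\<pi> ` ?A" by (rule image_eqI)
  qed
  then show "finite ?D" using fin finite_imageI finite_subset by blast
  have fibre: "(\<Sum>m | m \<in> ?A \<and> ?\<pi> m = n. weight (insert u S) \<Psi> m) = weight S (prune v u B \<Psi>) n"
    if mem: "n \<in> ?\<pi> ` ?A" for n
  proof -
    let ?F = "{i \<in> B. weight (insert u S) \<Psi> (n(u := i)) \<noteq> 0}"
    obtain m where m: "m \<in> ?A" "n = ?\<pi> m" by (rule imageE[OF mem]) blast
    have Pn: "P n" using m P by simp
    have eq: "{m. m \<in> ?A \<and> ?\<pi> m = n} = (\<lambda>i. n(u := i)) ` ?F"
    proof safe
      fix x assume x: "x \<in> support (insert u S) \<Psi>" "P x" "x u \<in> B" "n = ?\<pi> x"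
      then have "x = (?\<pi> x)(u := x u)" by simp
      then show "x \<in> (\<lambda>i. (?\<pi> x)(u := i)) ` {i \<in> B. weight (insert u S) \<Psi> ((?\<pi> x)(u := i)) \<noteq> 0}"
        using x by (intro image_eqI[of _ _ "x u"]) (auto simp: support_def)
    qed (use m Pn P in \<open>auto simp: support_def\<close>)
    have inj: "inj_on (\<lambda>i. n(u := i)) ?F" by (rule inj_onI) (metis fun_upd_same)
    show ?thesis
      unfolding eq wp(2)[of n]
      by (subst sum.reindex[OF inj]) simp
  qed
  have "(\<Sum>n\<in>?A. weight (insert u S) \<Psi> n)
    = (\<Sum>n\<in>?\<pi> ` ?A. \<Sum>m | m \<in> ?A \<and> ?\<pi> m = n. weight (insert u S) \<Psi> m)"
    by (rule sum.image_gen[OF fin])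
  also have "\<dots> = (\<Sum>n\<in>?\<pi> ` ?A. weight S (prune v u B \<Psi>) n)"
    by (rule sum.cong[OF refl fibre])
  also have "\<dots> = (\<Sum>n\<in>?D. weight S (prune v u B \<Psi>) n)"
  proof (rule sum.mono_neutral_right)
    show "finite (?\<pi> ` ?A)" using fin by blast
    show "\<forall>n\<in>?\<pi> ` ?A - ?D. weight S (prune v u B \<Psi>) n = 0"
      using P by (auto simp: support_def)
  qed (rule sub)
  finally show "(\<Sum>n\<in>?A. weight (insert u S) \<Psi> n) = (\<Sum>n\<in>?D. weight S (prune v u B \<Psi>) n)" .
qed

section \<open>Bounds that confine labellings\<close>

text \<open>
  For \<open>\<Psi> w j = X\<^sup>m\<close> the exponent at \<open>w\<close> is \<open>k\<^sub>w = - m - neighbour_sum S n w\<close>, and the inequality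
  says \<open>k\<^sub>w \<le> \<delta>\<^sub>w - 2\<close>.  For a Laurent polynomial one of its monomials has to satisfy it.
\<close>

definition confining :: "'v set \<Rightarrow> ('v \<Rightarrow> int \<Rightarrow> rat fls) \<Rightarrow> ('v \<Rightarrow> int) \<Rightarrow> bool" where
  "confining S \<Psi> X \<longleftrightarrow>
     (\<forall>n. (\<forall>w\<in>S. X w \<le> n w \<longrightarrow>
              (\<exists>m. \<Psi> w (n w) $$ m \<noteq> 0 \<and> 2 \<le> m + neighbour_sum S n w + int (card (neighbours S w)))) \<longrightarrow>
          (\<forall>w\<in>S. n w < X w))"

definition cofinally_confining :: "'v set \<Rightarrow> ('v \<Rightarrow> int \<Rightarrow> rat fls) \<Rightarrow> bool" where
  "cofinally_confining S \<Psi> \<longleftrightarrow> (\<forall>N. \<exists>X. (\<forall>w\<in>S. N \<le> X w) \<and> confining S \<Psi> X)"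

text \<open>
  Confining bounds beyond every \<open>N\<close> make all branch factors of iterated prunings Laurent polynomials; the
  finiteness condition makes the counting sums meaningful.
\<close>

definition admissible :: "'v set \<Rightarrow> ('v \<Rightarrow> int \<Rightarrow> rat fls) \<Rightarrow> bool" where
  "admissible S \<Psi> \<longleftrightarrow> (\<forall>w\<in>S. \<forall>j. normalized (\<Psi> w j)) \<and> cofinally_confining S \<Psi>
     \<and> (\<forall>M. finite {n \<in> support S \<Psi>. \<exists>w\<in>S. n w < M})"

text \<open>
  A labelling \<open>n\<close> that violates the property after pruning extends to one that violates it before.  If a
  monomial \<open>m\<close> of the new series at \<open>v\<close> is the product of \<open>m\<^sub>1\<close> from the old series and \<open>m - m\<^sub>1\<close> from the branch
  factor, then the partial sums of the branch factor jump at \<open>m - m\<^sub>1\<close>.  So the branch series differs from \<open>1\<close> at \<open>m - m\<^sub>1\<close> or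
  just before it, and the leaf is given a label where this happens; the loss of \<open>1\<close> is
  compensated by the larger valency of \<open>v\<close>.
\<close>

lemma confining_prune:
  assumes pend: "pendant S u v" and conf: "confining (insert u S) \<Psi> X"
    and norm: "\<And>i. normalized (\<Psi> u i)" and pr: "prunable (\<Psi> u) B"
    and B: "\<And>i. X u \<le> i \<Longrightarrow> i \<in> B"
  shows "confining S (prune v u B \<Psi>) X"
  unfolding confining_def
proof (intro allI impI)
  fix n :: "'v \<Rightarrow> int"
  assume n: "\<forall>w\<in>S. X w \<le> n w \<longrightarrow> (\<exists>m. prune v u B \<Psi> w (n w) $$ m \<noteq> 0
    \<and> 2 \<le> m + neighbour_sum S n w + int (card (neighbours S w)))"
  note nb = pendant_neighbours[OF pend] and nbs = pendant_neighbour_sum[OF pend]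
  have "\<exists>i. (i \<in> B \<longrightarrow> X u \<le> i \<longrightarrow> partial_sum (\<Psi> u i) (- n v) \<noteq> 1) \<and>
    (X v \<le> n v \<longrightarrow> (\<exists>m. \<Psi> v (n v) $$ m \<noteq> 0 \<and> 1 \<le> m + (neighbour_sum S n v + i) + int (card (neighbours S v))))"
  proof (cases "X v \<le> n v")
    case True
    then obtain m where m: "(\<Psi> v (n v) * branch_factor (\<Psi> u) B (n v)) $$ m \<noteq> 0"
        "2 \<le> m + neighbour_sum S n v + int (card (neighbours S v))"
      using n nb(2) by (auto simp: prune_def)
    obtain m1 where m1: "\<Psi> v (n v) $$ m1 \<noteq> 0" "branch_factor (\<Psi> u) B (n v) $$ (m - m1) \<noteq> 0"
      using fls_times_nth_neq_0E[OF m(1)] by blast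
    let ?b = "branch_series (\<Psi> u) B (n v)"
    have "?b $$ (m - m1) - ?b $$ (m - m1 - 1) \<noteq> 0"
      using m1(2) by (simp add: branch_factor_def fls_times_one_minus_X_nth)
    then obtain i where i: "i = m - m1 \<or> i = m - m1 - 1" "?b $$ i \<noteq> 1" by (metis diff_self)
    then have "i \<in> B \<longrightarrow> partial_sum (\<Psi> u i) (- n v) \<noteq> 1" by (auto simp: branch_series_nth[OF pr])
    moreover have "1 \<le> m1 + (neighbour_sum S n v + i) + int (card (neighbours S v))" using i(1) m(2) by auto
    ultimately show ?thesis using m1(1) by blast
  next
    case False
    (* Below the bound there is no condition, neither at v nor at the leaf. *)
    then show ?thesis by (intro exI[of _ "X u - 1"]) auto
  qed
  then obtain i where i: "i \<in> B \<Longrightarrow> X u \<le> i \<Longrightarrow> partial_sum (\<Psi> u i) (- n v) \<noteq> 1"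
    and iv: "X v \<le> n v \<Longrightarrow> \<exists>m. \<Psi> v (n v) $$ m \<noteq> 0 \<and> 1 \<le> m + (neighbour_sum S n v + i) + int (card (neighbours S v))"
    by blast
  let ?n = "n(u := i)" and ?S = "insert u S"
  have "\<exists>m. \<Psi> w (?n w) $$ m \<noteq> 0 \<and> 2 \<le> m + neighbour_sum ?S ?n w + int (card (neighbours ?S w))"
    if w: "w \<in> ?S" "X w \<le> ?n w" for w
  proof -
    consider "w = u" | "w = v" | "w \<in> S" "w \<noteq> v" "w \<noteq> u" using w(1) by blast
    then show ?thesis
    proof cases
      case 1
      then have "partial_sum (\<Psi> u i) (- n v) \<noteq> 1" using i B w by simp
      then obtain m where "- n v < m" "\<Psi> u i $$ m \<noteq> 0" using partial_sum_eq_1[OF norm] by blast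
      then show ?thesis using 1 nb nbs(1)[of ?n] by (intro exI[of _ m]) auto
    next
      case 2
      then obtain m where "\<Psi> v (n v) $$ m \<noteq> 0" "1 \<le> m + (neighbour_sum S n v + i) + int (card (neighbours S v))"
        using iv w nb(3) by auto
      then show ?thesis using 2 nb nbs(2)[of n i] by (intro exI[of _ m]) auto
    next
      case 3
      then have "X w \<le> n w" "prune v u B \<Psi> w = \<Psi> w" using w by (auto simp: prune_def)
      then show ?thesis using n[rule_format, OF 3(1)] 3 nb(7)[OF 3(1,2)] nbs(3)[OF 3(1,2)] by simp
    qed
  qed
  then have all: "\<forall>w\<in>?S. ?n w < X w"
    using conf unfolding confining_def by blast
  show "\<forall>w\<in>S. n w < X w"
  proof
    fix w assume "w \<in> S"
    then show "n w < X w" using all nb(1) by (cases "w = u") auto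
  qed
qed

lemma prunable_contains_large:
  assumes "prunable f B"
  obtains M where "\<And>i. M \<le> i \<Longrightarrow> i \<in> B"
proof -
  obtain M where "0 < M" and M: "\<And>i. (if i \<in> B then partial_sum (f i) (- 0) else 0) \<noteq> (if 0 \<le> i then 1 else 0)
      \<Longrightarrow> - M < i \<and> i < M"
    using finite_int_set_bounded assms[unfolded prunable_def, rule_format, of 0]
    by (metis (mono_tags, lifting) mem_Collect_eq)
  show thesis
  proof (rule that[of M], rule ccontr)
    fix i assume i: "M \<le> i" "i \<notin> B"
    then show False using M[of i] \<open>0 < M\<close> by simp
  qed
qed

lemma admissible_prune:
  assumes pend: "pendant S u v" and adm: "admissible (insert u S) \<Psi>" and pr: "prunable (\<Psi> u) B"
  shows "admissible S (prune v u B \<Psi>)"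
  unfolding admissible_def
proof (intro conjI allI ballI)
  have norm: "normalized (\<Psi> u i)" for i using adm by (simp add: admissible_def)
  show "normalized (prune v u B \<Psi> w j)" if "w \<in> S" for w j
    using that adm normalized_mult normalized_branch_factor[OF pr]
    by (auto simp: prune_def admissible_def)
  show "cofinally_confining S (prune v u B \<Psi>)"
    unfolding cofinally_confining_def
  proof
    fix N
    obtain M where M: "\<And>i. M \<le> i \<Longrightarrow> i \<in> B" using prunable_contains_large[OF pr] by blast
    obtain X where X: "\<forall>w\<in>insert u S. max N M \<le> X w" "confining (insert u S) \<Psi> X"
      using adm unfolding admissible_def cofinally_confining_def by blast
    have "confining S (prune v u B \<Psi>) X"
      by (rule confining_prune[OF pend X(2) norm pr]) (use X(1) M in force)
    then show "\<exists>X. (\<forall>w\<in>S. N \<le> X w) \<and> confining S (prune v u B \<Psi>) X" using X(1) by auto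
  qed
  fix M
  have u: "u \<notin> S" using pend by (simp add: pendant_def)
  have "finite {n \<in> support (insert u S) \<Psi>. \<exists>w\<in>insert u S. n w < M}"
    using adm by (simp add: admissible_def)
  then have "finite {n \<in> support (insert u S) \<Psi>. (\<exists>w\<in>S. n w < M) \<and> n u \<in> B}"
    by (rule rev_finite_subset) blast
  moreover have "(\<exists>w\<in>S. (n(u := i)) w < M) \<longleftrightarrow> (\<exists>w\<in>S. n w < M)" for n :: "'v \<Rightarrow> int" and i
    using u by (metis fun_upd_other)
  ultimately show "finite {n \<in> support S (prune v u B \<Psi>). \<exists>w\<in>S. n w < M}"
    by (intro sum_prune(1)[of S u v \<Psi> B "\<lambda>n. \<exists>w\<in>S. n w < M", OF pend pr])
qed

text \<open>
  Otherwise the leaf series has a monomial above \<open>- j\<close>, and the labelling that is below \<open>X\<close> everywhere except at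
  the leaf contradicts the confining property.
\<close>

lemma leaf_saturated:
  assumes pend: "pendant S u v" and conf: "confining (insert u S) \<Psi> X"
    and norm: "normalized (\<Psi> u i)" and "X u \<le> i" and "j < X v"
  shows "partial_sum (\<Psi> u i) (- j) = 1"
proof (rule ccontr)
  assume "partial_sum (\<Psi> u i) (- j) \<noteq> 1"
  then obtain m where m: "- j < m" "\<Psi> u i $$ m \<noteq> 0" using partial_sum_eq_1[OF norm] by blast
  note nb = pendant_neighbours[OF pend] and nbs = pendant_neighbour_sum[OF pend]
  let ?n = "(\<lambda>w. X w - 1)(u := i, v := j)"
  have "\<exists>m. \<Psi> w (?n w) $$ m \<noteq> 0 \<and> 2 \<le> m + neighbour_sum (insert u S) ?n w + int (card (neighbours (insert u S) w))"
    if "w \<in> insert u S" "X w \<le> ?n w" for w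
  proof -
    have "w = u" using that \<open>j < X v\<close> by (auto split: if_splits)
    then show ?thesis using m nb nbs(1)[of ?n] by (intro exI[of _ m]) auto
  qed
  then have "\<forall>w\<in>insert u S. ?n w < X w" using conf unfolding confining_def by blast
  then show False using \<open>X u \<le> i\<close> nb(3) by auto
qed

lemma leaf_eventually_saturated:
  assumes pend: "pendant S u v" and adm: "admissible (insert u S) \<Psi>"
  obtains M where "\<And>i. M \<le> i \<Longrightarrow> partial_sum (\<Psi> u i) (- j) = 1"
proof -
  obtain X where X: "\<forall>w\<in>insert u S. j + 1 \<le> X w" "confining (insert u S) \<Psi> X"
    using adm unfolding admissible_def cofinally_confining_def by blast
  show thesis
  proof (rule that[of "X u"])
    fix i assume "X u \<le> i"
    moreover have "j < X v" using X(1) pendant_neighbours(2)[OF pend] by force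
    moreover have "normalized (\<Psi> u i)" using adm by (simp add: admissible_def)
    ultimately show "partial_sum (\<Psi> u i) (- j) = 1" using leaf_saturated[OF pend X(2)] by blast
  qed
qed

lemma prunable_atLeast:
  assumes pend: "pendant S u v" and adm: "admissible (insert u S) \<Psi>"
  shows "prunable (\<Psi> u) {c..}"
  unfolding prunable_def
proof
  fix j
  obtain M where M: "\<And>i. M \<le> i \<Longrightarrow> partial_sum (\<Psi> u i) (- j) = 1"
    using leaf_eventually_saturated[OF assms] by blast
  show "finite {i. (if i \<in> {c..} then partial_sum (\<Psi> u i) (- j) else 0) \<noteq> (if 0 \<le> i then 1 else 0)}"
  proof (rule finite_subset)
    show "{i. (if i \<in> {c..} then partial_sum (\<Psi> u i) (- j) else 0) \<noteq> (if 0 \<le> i then 1 else 0)}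
      \<subseteq> {min c 0..max M (max c 0)}"
    proof
      fix i assume i: "i \<in> {i. (if i \<in> {c..} then partial_sum (\<Psi> u i) (- j) else 0) \<noteq> (if 0 \<le> i then 1 else 0)}"
      have "min c 0 \<le> i" using i by (cases "i < c"; cases "i < 0") auto
      moreover have "i \<le> max M (max c 0)"
        using i M[of i] by (cases "M \<le> i"; cases "c \<le> i"; cases "0 \<le> i") auto
      ultimately show "i \<in> {min c 0..max M (max c 0)}" by simp
    qed
  qed simp
qed

text \<open>
  Labels at or above the bound everywhere except at the root: each branch then acts as if it were a
  single vertex carrying its lowest permitted label.  When a vertex adjacent to the root is
  removed, the branch series is saturated because the root is below the bound, so the branch
  factor is the monomial whose exponent is the bound.  Vertices farther away
  are absorbed into the series of the vertices before them.
\<close>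

lemma sum_truncated:
  assumes "subtree r S" and "admissible S \<Psi>" and "confining S \<Psi> X" and "i < X r"
  shows "(\<Sum>n | n \<in> support S \<Psi> \<and> n r = i \<and> (\<forall>w\<in>S - {r}. X w \<le> n w). weight S \<Psi> n)
    = partial_sum2 (\<Psi> r i) (- neighbour_sum S X r)"
  using assms
proof (induction arbitrary: \<Psi> rule: subtree.induct)
  case root
  have nb: "neighbours {r} r = {}" using adj_irrefl by (auto simp: neighbours_def)
  let ?n = "(\<lambda>_. 0)(r := i)"
  have w: "weight {r} \<Psi> n = partial_sum2 (\<Psi> r (n r)) 0" for n
    by (simp add: weight_def vertex_series_def partial_sum2_def partial_sum_def neighbour_sum_def nb
        power_int_minus power2_eq_square mult.assoc)
  have "{n. n \<in> support {r} \<Psi> \<and> n r = i \<and> (\<forall>w\<in>{r} - {r}. X w \<le> n w)} = (if weight {r} \<Psi> ?n = 0 then {} else {?n})"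
    by (auto simp: support_def w fun_eq_iff)
  then show ?case by (simp add: w neighbour_sum_def nb)
next
  case (grow S u v)
  note pend = grow.hyps(2)
  note nb = pendant_neighbours[OF pend] and nbs = pendant_neighbour_sum[OF pend]
  let ?\<Psi> = "prune v u {X u..} \<Psi>" and ?S = "insert u S"
  let ?P = "\<lambda>n. n r = i \<and> (\<forall>w\<in>S - {r}. X w \<le> n w)"
  have r: "r \<in> S" using grow.hyps(1) by (induction rule: subtree.induct) auto
  have ru: "r \<noteq> u" using r nb(1) by blast
  have norm: "normalized (\<Psi> u i)" for i using grow.prems(1) by (simp add: admissible_def)
  have pr: "prunable (\<Psi> u) {X u..}" by (rule prunable_atLeast[OF pend grow.prems(1)])
  have fin: "finite {n \<in> support ?S \<Psi>. ?P n \<and> n u \<in> {X u..}}"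
  proof (rule finite_subset)
    show "finite {n \<in> support ?S \<Psi>. \<exists>w\<in>?S. n w < i + 1}"
      using grow.prems(1) unfolding admissible_def by blast
  qed (use r in auto)
  have P: "?P (n(u := k)) \<longleftrightarrow> ?P n" for n k
    using ru nb(1) by (auto simp: fun_upd_def)
  have "(\<Sum>n | n \<in> support ?S \<Psi> \<and> n r = i \<and> (\<forall>w\<in>?S - {r}. X w \<le> n w). weight ?S \<Psi> n)
    = (\<Sum>n | n \<in> support ?S \<Psi> \<and> ?P n \<and> n u \<in> {X u..}. weight ?S \<Psi> n)"
    by (rule sum.cong) (use ru in auto)
  also have "\<dots> = (\<Sum>n | n \<in> support S ?\<Psi> \<and> ?P n. weight S ?\<Psi> n)"
    by (rule sum_prune(2)[of S u v \<Psi> "{X u..}" ?P, OF pend pr P fin])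
  also have "\<dots> = partial_sum2 (?\<Psi> r i) (- neighbour_sum S X r)"
  proof (rule grow.IH)
    show "admissible S ?\<Psi>" by (rule admissible_prune[OF pend grow.prems(1) pr])
    show "confining S ?\<Psi> X"
      by (rule confining_prune[OF pend grow.prems(2) norm pr]) simp
  qed (rule grow.prems(3))
  also have "\<dots> = partial_sum2 (\<Psi> r i) (- neighbour_sum ?S X r)"
  proof (cases "r = v")
    case False
    have "neighbour_sum ?S X r = neighbour_sum S X r" using nbs(3)[OF r False, of X "X u"] by simp
    then show ?thesis using False by (simp add: prune_def)
  next
    case True
    (* The branch factor is a single monomial, independent of the leaf series. *)
    have sat: "partial_sum (\<Psi> u k) (- i) = 1" if "X u \<le> k" for k
      using leaf_saturated[OF pend grow.prems(2) norm that] grow.prems(3) True by simp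
    have "branch_factor (\<Psi> u) {X u..} i = fls_shift (- X u) 1"
      by (intro fls_eqI)
        (auto simp: branch_factor_def fls_times_one_minus_X_nth branch_series_nth[OF pr] sat)
    then have "?\<Psi> r i = fls_shift (- X u) (\<Psi> r i)"
      using True by (simp add: prune_def fls_X_intpow_times_conv_shift)
    moreover have "neighbour_sum ?S X r = neighbour_sum S X r + X u" using nbs(2)[of X "X u"] True by simp
    moreover have "inverse (1 - fls_X) * (inverse (1 - fls_X) * fls_shift (- X u) (\<Psi> r i))
      = fls_shift (- X u) (inverse (1 - fls_X) * (inverse (1 - fls_X) * \<Psi> r i))"
      by (simp add: fls_shifted_times_simps)
    ultimately show ?thesis by (simp add: partial_sum2_def partial_sum_def)
  qed
  finally show ?case .
qed


definition counting_sum :: "'v set \<Rightarrow> ('v \<Rightarrow> int \<Rightarrow> rat fls) \<Rightarrow> ('v \<Rightarrow> int) \<Rightarrow> rat" where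
  "counting_sum S \<Psi> X = (\<Sum>n | n \<in> support S \<Psi> \<and> (\<exists>w\<in>S. n w < X w). weight S \<Psi> n)"

lemma finite_counting_index:
  assumes "admissible S \<Psi>"
  shows "finite {n. n \<in> support S \<Psi> \<and> (\<exists>w\<in>S. n w < X w)}"
proof (rule finite_subset)
  have "X w \<le> Max (range X)" for w by (rule Max_ge) auto
  then show "{n. n \<in> support S \<Psi> \<and> (\<exists>w\<in>S. n w < X w)} \<subseteq> {n \<in> support S \<Psi>. \<exists>w\<in>S. n w < Max (range X)}"
    by (blast intro: less_le_trans)
  show "finite {n \<in> support S \<Psi>. \<exists>w\<in>S. n w < Max (range X)}"
    using assms unfolding admissible_def by blast
qed

text \<open>
  Split the labellings according to whether some vertex of \<open>S\<close> is below the bound.  If so, the label of the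
  leaf is free and pruning applies.  If not, the leaf itself is below the bound and all other
  vertices are not, which is the situation of \<open>sum_truncated\<close> with the leaf as root.
\<close>

lemma counting_sum_insert:
  assumes sub: "subtree r S" and pend: "pendant S u v" and adm: "admissible (insert u S) \<Psi>"
    and conf: "confining (insert u S) \<Psi> X" and pr: "prunable (\<Psi> u) UNIV"
  obtains L0 where "\<And>L. L \<le> L0 \<Longrightarrow> counting_sum (insert u S) \<Psi> X
    = counting_sum S (prune v u UNIV \<Psi>) X + (\<Sum>i\<in>{L..<X u}. partial_sum2 (\<Psi> u i) (- X v))"
proof -
  let ?S = "insert u S"
  let ?A1 = "{n. n \<in> support ?S \<Psi> \<and> (\<exists>w\<in>S. n w < X w) \<and> n u \<in> UNIV}"
  let ?A2 = "{n. n \<in> support ?S \<Psi> \<and> n u < X u \<and> (\<forall>w\<in>S. X w \<le> n w)}"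
  note nb = pendant_neighbours[OF pend]
  have fin: "finite {n. n \<in> support ?S \<Psi> \<and> (\<exists>w\<in>?S. n w < X w)}" by (rule finite_counting_index[OF adm])
  have fin1: "finite ?A1" and fin2: "finite ?A2"
    by (rule finite_subset[OF _ fin]; auto)+
  have "{n. n \<in> support ?S \<Psi> \<and> (\<exists>w\<in>?S. n w < X w)} = ?A1 \<union> ?A2"
    using linorder_not_le by auto
  then have "counting_sum ?S \<Psi> X = (\<Sum>n\<in>?A1 \<union> ?A2. weight ?S \<Psi> n)"
    unfolding counting_sum_def by (simp only:)
  also have "\<dots> = (\<Sum>n\<in>?A1. weight ?S \<Psi> n) + (\<Sum>n\<in>?A2. weight ?S \<Psi> n)"
    by (rule sum.union_disjoint[OF fin1 fin2]) force
  also have "(\<Sum>n\<in>?A1. weight ?S \<Psi> n) = counting_sum S (prune v u UNIV \<Psi>) X"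
    unfolding counting_sum_def
  proof (rule sum_prune(2)[of S u v \<Psi> UNIV "\<lambda>n. \<exists>w\<in>S. n w < X w", OF pend pr])
    show "(\<exists>w\<in>S. (n(u := i)) w < X w) \<longleftrightarrow> (\<exists>w\<in>S. n w < X w)" for n :: "'v \<Rightarrow> int" and i
      using nb(1) by (metis fun_upd_other)
  qed (use fin1 in simp)
  finally have eq: "counting_sum ?S \<Psi> X = counting_sum S (prune v u UNIV \<Psi>) X + (\<Sum>n\<in>?A2. weight ?S \<Psi> n)" .
  have root: "subtree u ?S"
    by (rule subtree_reroot[OF subtree.grow[OF sub pend]]) simp
  have fibre: "(\<Sum>n | n \<in> ?A2 \<and> n u = i. weight ?S \<Psi> n) = partial_sum2 (\<Psi> u i) (- X v)" if "i < X u" for i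
  proof -
    have "(\<Sum>n | n \<in> ?A2 \<and> n u = i. weight ?S \<Psi> n)
      = (\<Sum>n | n \<in> support ?S \<Psi> \<and> n u = i \<and> (\<forall>w\<in>?S - {u}. X w \<le> n w). weight ?S \<Psi> n)"
      by (rule sum.cong) (use that nb(1) in auto)
    also have "\<dots> = partial_sum2 (\<Psi> u i) (- neighbour_sum ?S X u)"
      by (rule sum_truncated[OF root adm conf that])
    finally show ?thesis by (simp add: pendant_neighbour_sum(1)[OF pend])
  qed
  show thesis
  proof (rule that)
    fix L assume L: "L \<le> Min (insert 0 ((\<lambda>n. n u) ` ?A2))"
    have "(\<lambda>n. n u) ` ?A2 \<subseteq> {L..<X u}"
    proof safe
      fix n assume "n \<in> support ?S \<Psi>" "n u < X u" "\<forall>w\<in>S. X w \<le> n w"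
      then have "Min (insert 0 ((\<lambda>n. n u) ` ?A2)) \<le> n u" using fin2 by (intro Min_le) auto
      then show "n u \<in> {L..<X u}" using L \<open>n u < X u\<close> by simp
    qed
    then have "(\<Sum>n\<in>?A2. weight ?S \<Psi> n) = (\<Sum>i\<in>{L..<X u}. \<Sum>n | n \<in> ?A2 \<and> n u = i. weight ?S \<Psi> n)"
      by (intro sum.group[symmetric] fin2) simp_all
    also have "\<dots> = (\<Sum>i\<in>{L..<X u}. partial_sum2 (\<Psi> u i) (- X v))"
      by (rule sum.cong) (use fibre in auto)
    finally show "counting_sum ?S \<Psi> X
      = counting_sum S (prune v u UNIV \<Psi>) X + (\<Sum>i\<in>{L..<X u}. partial_sum2 (\<Psi> u i) (- X v))"
      using eq by simp
  qed
qed

section \<open>Duality of counting sums\<close>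

text \<open>
  The dual labelling is \<open>- 1 - n\<close>.  With it, exponents \<open>k\<close> and \<open>\<delta> - 2 - k\<close> correspond to each other iff
  the series are reflected about \<open>2\<close>: each neighbour contributes \<open>1\<close> to the shift, which gives \<open>\<delta>\<close>, and the
  remaining \<open>- 2\<close> comes from the reflection.
\<close>

definition dual_data :: "'v set \<Rightarrow> ('v \<Rightarrow> int \<Rightarrow> rat fls) \<Rightarrow> ('v \<Rightarrow> int \<Rightarrow> rat fls) \<Rightarrow> bool" where
  "dual_data S \<Psi> \<Phi> \<longleftrightarrow> (\<forall>w\<in>S. \<forall>j. reflected 2 (\<Psi> w j) (\<Phi> w (- 1 - j)))"

lemma dual_data_sym: "dual_data S \<Psi> \<Phi> \<Longrightarrow> dual_data S \<Phi> \<Psi>"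
  unfolding dual_data_def reflected_def
proof (intro ballI allI)
  fix w j k
  assume "\<forall>w\<in>S. \<forall>j k. \<Phi> w (- 1 - j) $$ k = \<Psi> w j $$ (2 - k)" and "w \<in> S"
  then have "\<Phi> w (- 1 - (- 1 - j)) $$ (2 - k) = \<Psi> w (- 1 - j) $$ (2 - (2 - k))" by blast
  then show "\<Psi> w (- 1 - j) $$ k = \<Phi> w j $$ (2 - k)" by simp
qed

text \<open>
  The two weights of a leaf come from the expansions of the same function \<open>f / (1 - X)\<close> at \<open>0\<close> and at infinity, up to
  sign, and the former minus the latter expansion has all coefficients \<open>f(1) = 1\<close>.
\<close>

lemma dual_partial_sum:
  assumes "dual_data S \<Psi> \<Phi>" and "w \<in> S" and "normalized (\<Psi> w i)"
  shows "partial_sum (\<Phi> w (- 1 - i)) (- (- 1 - j)) = 1 - partial_sum (\<Psi> w i) (- j)"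
  using partial_sum_reflected[OF assms(3), of 2 "\<Phi> w (- 1 - i)" "1 + j"] assms(1,2)
  unfolding dual_data_def by (simp add: add.commute)

text \<open>
  Saturation for large labels of the leaf holds for both data, and complementarity turns it into
  vanishing for very negative labels.
\<close>

lemma prunable_UNIV:
  assumes pend: "pendant S u v" and adm: "admissible (insert u S) \<Psi>" "admissible (insert u S) \<Phi>"
    and dual: "dual_data (insert u S) \<Psi> \<Phi>"
  shows "prunable (\<Psi> u) UNIV"
  unfolding prunable_def
proof
  fix j
  obtain M where M: "\<And>i. M \<le> i \<Longrightarrow> partial_sum (\<Psi> u i) (- j) = 1"
    using leaf_eventually_saturated[OF pend adm(1)] by blast
  obtain M' where M': "\<And>i. M' \<le> i \<Longrightarrow> partial_sum (\<Phi> u i) (- (- 1 - j)) = 1"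
    using leaf_eventually_saturated[OF pend adm(2)] by blast
  have low: "partial_sum (\<Psi> u i) (- j) = 0" if "i \<le> - 1 - M'" for i
    using dual_partial_sum[OF dual, of u i j] M'[of "- 1 - i"] that adm(1) by (simp add: admissible_def)
  show "finite {i. (if i \<in> UNIV then partial_sum (\<Psi> u i) (- j) else 0) \<noteq> (if 0 \<le> i then 1 else 0)}"
  proof (rule finite_subset)
    show "{i. (if i \<in> UNIV then partial_sum (\<Psi> u i) (- j) else 0) \<noteq> (if 0 \<le> i then 1 else 0)}
      \<subseteq> {min (- 1 - M') 0..max M 0}"
    proof
      fix i assume i: "i \<in> {i. (if i \<in> UNIV then partial_sum (\<Psi> u i) (- j) else 0) \<noteq> (if 0 \<le> i then 1 else 0)}"
      have "min (- 1 - M') 0 \<le> i" using i low[of i] by (cases "i \<le> - 1 - M'"; cases "i < 0") auto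
      moreover have "i \<le> max M 0" using i M[of i] by (cases "M \<le> i"; cases "0 \<le> i") auto
      ultimately show "i \<in> {min (- 1 - M') 0..max M 0}" by simp
    qed
  qed simp
qed

lemma dual_data_prune:
  assumes pend: "pendant S u v" and dual: "dual_data (insert u S) \<Psi> \<Phi>"
    and norm: "\<And>i. normalized (\<Psi> u i)"
    and pr: "prunable (\<Psi> u) UNIV" "prunable (\<Phi> u) UNIV"
  shows "dual_data S (prune v u UNIV \<Psi>) (prune v u UNIV \<Phi>)"
proof -
  have "reflected 0 (branch_factor (\<Psi> u) UNIV j) (branch_factor (\<Phi> u) UNIV (- 1 - j))" for j
    unfolding reflected_def
  proof
    fix k
    have b: "branch_series (\<Phi> u) UNIV (- 1 - j) $$ i = 1 - branch_series (\<Psi> u) UNIV j $$ (- 1 - i)" for i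
      using dual_partial_sum[OF dual, of u "- 1 - i" j] norm
      by (simp add: branch_series_nth[OF pr(1)] branch_series_nth[OF pr(2)])
    show "branch_factor (\<Phi> u) UNIV (- 1 - j) $$ k = branch_factor (\<Psi> u) UNIV j $$ (0 - k)"
      using b[of k] b[of "k - 1"]
      by (simp add: branch_factor_def fls_times_one_minus_X_nth minus_diff_commute)
  qed
  then have "reflected (2 + 0) (\<Psi> v j * branch_factor (\<Psi> u) UNIV j)
      (\<Phi> v (- 1 - j) * branch_factor (\<Phi> u) UNIV (- 1 - j))" for j
    using dual pendant_neighbours(2)[OF pend] by (intro reflected_mult) (auto simp: dual_data_def)
  then show ?thesis using dual by (auto simp: dual_data_def prune_def)
qed

text \<open>
  Induction by pruning.  With \<open>p i j\<close> the weight of the leaf \<open>u\<close> with label \<open>i\<close> next to \<open>v\<close> with label \<open>j\<close>, the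
  step subtracts the sum of \<open>p\<close> over the box \<open>0 \<le> i < X u\<close>, \<open>0 \<le> j < X v\<close>.  In this range of \<open>j\<close> the sum of the excess of the branch
  factor is the sum of \<open>p i j - 1\<close> over \<open>0 \<le> i < X u\<close>, since \<open>p\<close> vanishes for negative \<open>i\<close> and is \<open>1\<close> for \<open>i \<ge> X u\<close>.
  So the vertex term of \<open>v\<close> changes by the same sum of \<open>p\<close> less \<open>X u * X v\<close>, and only the product
  \<open>X u * X v\<close> survives for the edge.  The edge sum counts each edge twice, hence the
  factor \<open>1/2\<close>.
\<close>

theorem counting_sum_duality:
  assumes "subtree r S" and "admissible S \<Psi>" and "admissible S \<Phi>" and "dual_data S \<Psi> \<Phi>"
    and "confining S \<Psi> X" and "confining S \<Phi> (\<lambda>_. 0)" and "\<And>w. w \<in> S \<Longrightarrow> 0 \<le> X w"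
  shows "counting_sum S \<Psi> X - counting_sum S \<Phi> (\<lambda>_. 0)
    = (\<Sum>w\<in>S. \<Sum>j\<in>{0..<X w}. 1 + coeff_sum (excess (\<Psi> w j)))
      - of_int (\<Sum>w\<in>S. X w * neighbour_sum S X w) / 2"
  using assms
proof (induction arbitrary: \<Psi> \<Phi> rule: subtree.induct)
  case root
  have nb: "neighbours {r} r = {}" using adj_irrefl by (auto simp: neighbours_def)
  have w: "weight {r} F n = partial_sum2 (F r (n r)) 0" for F n
    by (simp add: weight_def vertex_series_def partial_sum2_def partial_sum_def neighbour_sum_def nb
        power_int_minus power2_eq_square mult.assoc)
  have cnt: "\<exists>L0. \<forall>L\<le>L0. counting_sum {r} F Y = (\<Sum>i\<in>{L..<Y r}. partial_sum2 (F r i) 0)"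
    if "admissible {r} F" for F Y
  proof -
    let ?A = "{n. n \<in> support {r} F \<and> (\<exists>w\<in>{r}. n w < Y w)}"
    let ?I = "(\<lambda>n. n r) ` ?A"
    have fin: "finite ?A" by (rule finite_counting_index[OF that])
    have inj: "inj_on (\<lambda>n. n r) ?A"
    proof (rule inj_onI, rule ext)
      fix n n' :: "'v \<Rightarrow> int" and w
      assume "n \<in> ?A" "n' \<in> ?A" "n r = n' r"
      then show "n w = n' w" by (cases "w = r") (auto simp: support_def)
    qed
    have "counting_sum {r} F Y = (\<Sum>i\<in>?I. partial_sum2 (F r i) 0)"
      unfolding counting_sum_def by (subst sum.reindex[OF inj]) (simp add: w)
    moreover have "(\<Sum>i\<in>?I. partial_sum2 (F r i) 0) = (\<Sum>i\<in>{L..<Y r}. partial_sum2 (F r i) 0)"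
      if L: "L \<le> Min (insert 0 ?I)" for L
    proof (rule sum.mono_neutral_left)
      have "Min (insert 0 ?I) \<le> i" if "i \<in> ?I" for i using fin that by (intro Min_le) auto
      then have "L \<le> i" if "i \<in> ?I" for i using L that order_trans by blast
      then show "?I \<subseteq> {L..<Y r}" by auto
      show "\<forall>i\<in>{L..<Y r} - ?I. partial_sum2 (F r i) 0 = 0"
      proof
        fix i assume i: "i \<in> {L..<Y r} - ?I"
        show "partial_sum2 (F r i) 0 = 0"
        proof (rule ccontr)
          assume "partial_sum2 (F r i) 0 \<noteq> 0"
          then have "(\<lambda>_. 0)(r := i) \<in> ?A" using i by (simp add: support_def w)
          then have "i \<in> ?I" by (rule rev_image_eqI) simp
          then show False using i by blast
        qed
      qed
    qed simp
    ultimately show ?thesis by (intro exI[of _ "Min (insert 0 ?I)"]) simp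
  qed
  have norm: "normalized (\<Psi> r i)" "normalized (\<Phi> r i)" for i
    using root.prems(1,2) by (simp_all add: admissible_def)
  have sat: "partial_sum (F r i) (- j) = 1"
    if conf: "confining {r} F Y" and nm: "normalized (F r i)" and "Y r \<le> i" and "j < 0" for F Y i j
  proof (rule ccontr)
    assume "partial_sum (F r i) (- j) \<noteq> 1"
    then obtain m where "- j < m" "F r i $$ m \<noteq> 0" using partial_sum_eq_1[OF nm] by blast
    then have "\<exists>m. F r i $$ m \<noteq> 0 \<and> 2 \<le> m + neighbour_sum {r} (\<lambda>_. i) r + int (card (neighbours {r} r))"
      using \<open>j < 0\<close> by (intro exI[of _ m]) (auto simp: nb neighbour_sum_def)
    then have "\<forall>w\<in>{r}. i < Y w"
      using conf[unfolded confining_def, rule_format, of "\<lambda>_. i"] by simp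
    then show False using \<open>Y r \<le> i\<close> by simp
  qed
  have vanish: "partial_sum (\<Psi> r i) (- j) = 0" if "i < 0" "0 \<le> j" for i j
    using sat[OF root.prems(5) norm(2), of "- 1 - i" "- 1 - j"] that
      dual_partial_sum[OF root.prems(3), of r i j] norm(1)[of i] by simp
  obtain L1 where L1: "\<forall>L\<le>L1. counting_sum {r} \<Psi> X = (\<Sum>i\<in>{L..<X r}. partial_sum2 (\<Psi> r i) 0)"
    using cnt[OF root.prems(1)] by blast
  obtain L2 where L2: "\<forall>L\<le>L2. counting_sum {r} \<Phi> (\<lambda>_. 0) = (\<Sum>i\<in>{L..<0}. partial_sum2 (\<Phi> r i) 0)"
    using cnt[OF root.prems(2), of "\<lambda>_. 0"] by blast
  (* A single vertex behaves like a leaf next to a vertex with bound 0. *)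
  have "(\<Sum>i\<in>{min L1 0..<X r}. partial_sum2 (\<Psi> r i) (- 0))
      - (\<Sum>i\<in>{min L2 (- X r)..<0}. partial_sum2 (\<Phi> r i) 0)
    = (\<Sum>i\<in>{0..<X r}. 1 + coeff_sum (excess (\<Psi> r i)))
      - (\<Sum>i\<in>{0..<X r}. \<Sum>j\<in>{0..<0}. partial_sum (\<Psi> r i) (- j))"
    by (rule sum_partial_sum2_difference[OF norm(1)])
      (use root.prems sat[OF root.prems(4) norm(1)] vanish in \<open>auto simp: dual_data_def\<close>)
  moreover have "counting_sum {r} \<Psi> X = (\<Sum>i\<in>{min L1 0..<X r}. partial_sum2 (\<Psi> r i) (- 0))"
    using L1[rule_format, of "min L1 0"] by simp
  moreover have "counting_sum {r} \<Phi> (\<lambda>_. 0) = (\<Sum>i\<in>{min L2 (- X r)..<0}. partial_sum2 (\<Phi> r i) 0)"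
    using L2[rule_format, of "min L2 (- X r)"] by simp
  ultimately show ?case by (simp add: neighbour_sum_def nb)
next
  case (grow S u v)
  note sub = grow.hyps(1) and pend = grow.hyps(2)
  note nb = pendant_neighbours[OF pend] and nbs = pendant_neighbour_sum[OF pend]
  let ?S = "insert u S"
  let ?\<Psi> = "prune v u UNIV \<Psi>" and ?\<Phi> = "prune v u UNIV \<Phi>"
  let ?p = "\<lambda>i j. partial_sum (\<Psi> u i) (- j)"
  have norm: "normalized (\<Psi> w i)" "normalized (\<Phi> w i)" if "w \<in> ?S" for w i
    using grow.prems(1,2) that unfolding admissible_def by blast+
  have X: "0 \<le> X u" "0 \<le> X v" using grow.prems(6) nb(2) by blast+
  have pr: "prunable (\<Psi> u) UNIV"
    by (rule prunable_UNIV[OF pend grow.prems(1,2,3)])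
  have pr': "prunable (\<Phi> u) UNIV"
    by (rule prunable_UNIV[OF pend grow.prems(2,1) dual_data_sym[OF grow.prems(3)]])
  have sat: "?p i j = 1" if "X u \<le> i" "j < X v" for i j
    by (rule leaf_saturated[OF pend grow.prems(4) _ that]) (simp add: norm)
  (* This is saturation of the dual leaf at the bound 0. *)
  have vanish: "?p i j = 0" if "i < 0" "0 \<le> j" for i j
  proof -
    have "partial_sum (\<Phi> u (- 1 - i)) (- (- 1 - j)) = 1"
      by (rule leaf_saturated[OF pend grow.prems(5)]) (use that in \<open>simp_all add: norm\<close>)
    then show ?thesis using dual_partial_sum[OF grow.prems(3), of u i j] norm(1)[of u i] by simp
  qed
  obtain L1 where L1: "\<And>L. L \<le> L1 \<Longrightarrow>
      counting_sum ?S \<Psi> X = counting_sum S ?\<Psi> X + (\<Sum>i\<in>{L..<X u}. partial_sum2 (\<Psi> u i) (- X v))"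
    using counting_sum_insert[OF sub pend grow.prems(1,4) pr] by metis
  obtain L2 where L2: "\<And>L. L \<le> L2 \<Longrightarrow>
      counting_sum ?S \<Phi> (\<lambda>_. 0) = counting_sum S ?\<Phi> (\<lambda>_. 0) + (\<Sum>i\<in>{L..<0}. partial_sum2 (\<Phi> u i) (- 0))"
    using counting_sum_insert[OF sub pend grow.prems(2,5) pr'] by metis
  have "(\<Sum>i\<in>{min L1 0..<X u}. partial_sum2 (\<Psi> u i) (- X v))
      - (\<Sum>i\<in>{min L2 (- X u)..<0}. partial_sum2 (\<Phi> u i) 0)
    = (\<Sum>i\<in>{0..<X u}. 1 + coeff_sum (excess (\<Psi> u i))) - (\<Sum>i\<in>{0..<X u}. \<Sum>j\<in>{0..<X v}. ?p i j)"
    by (rule sum_partial_sum2_difference)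
      (use grow.prems(3) norm sat vanish X in \<open>auto simp: dual_data_def\<close>)
  then have step: "counting_sum ?S \<Psi> X - counting_sum ?S \<Phi> (\<lambda>_. 0) = counting_sum S ?\<Psi> X - counting_sum S ?\<Phi> (\<lambda>_. 0)
    + (\<Sum>i\<in>{0..<X u}. 1 + coeff_sum (excess (\<Psi> u i))) - (\<Sum>i\<in>{0..<X u}. \<Sum>j\<in>{0..<X v}. ?p i j)"
    using L1[of "min L1 0"] L2[of "min L2 (- X u)"] by simp
  have IH: "counting_sum S ?\<Psi> X - counting_sum S ?\<Phi> (\<lambda>_. 0)
    = (\<Sum>w\<in>S. \<Sum>j\<in>{0..<X w}. 1 + coeff_sum (excess (?\<Psi> w j))) - of_int (\<Sum>w\<in>S. X w * neighbour_sum S X w) / 2"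
  proof (rule grow.IH)
    show "admissible S ?\<Psi>" by (rule admissible_prune[OF pend grow.prems(1) pr])
    show "admissible S ?\<Phi>" by (rule admissible_prune[OF pend grow.prems(2) pr'])
    show "dual_data S ?\<Psi> ?\<Phi>" by (rule dual_data_prune[OF pend grow.prems(3) _ pr pr']) (simp add: norm)
    show "confining S ?\<Psi> X" by (rule confining_prune[OF pend grow.prems(4) _ pr]) (simp_all add: norm)
    show "confining S ?\<Phi> (\<lambda>_. 0)" by (rule confining_prune[OF pend grow.prems(5) _ pr']) (simp_all add: norm)
  qed (use grow.prems(6) in simp)
  have factor: "coeff_sum (excess (branch_factor (\<Psi> u) UNIV j)) = (\<Sum>i\<in>{0..<X u}. ?p i j - 1)"
    if "j \<in> {0..<X v}" for j
  proof -
    have e: "excess (branch_factor (\<Psi> u) UNIV j) $$ i = ?p i j - (if 0 \<le> i then 1 else 0)" for i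
      by (simp add: excess_nth partial_sum_branch_factor branch_series_nth[OF pr])
    have "excess (branch_factor (\<Psi> u) UNIV j) $$ i = 0" if "i \<notin> {0..<X u}" for i
      using that \<open>j \<in> {0..<X v}\<close> sat[of i j] vanish[of i j] X unfolding e by (cases "i < 0") auto
    then have "coeff_sum (excess (branch_factor (\<Psi> u) UNIV j))
      = (\<Sum>i\<in>{0..<X u}. excess (branch_factor (\<Psi> u) UNIV j) $$ i)"
      by (intro coeff_sum_superset[OF finite_atLeastLessThan_int]) blast
    then show ?thesis by (simp add: e)
  qed
  have "(\<Sum>j\<in>{0..<X v}. 1 + coeff_sum (excess (?\<Psi> v j)))
    = (\<Sum>j\<in>{0..<X v}. (1 + coeff_sum (excess (\<Psi> v j))) + (\<Sum>i\<in>{0..<X u}. ?p i j - 1))"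
  proof (rule sum.cong)
    fix j assume j: "j \<in> {0..<X v}"
    have "coeff_sum (excess (?\<Psi> v j))
      = coeff_sum (excess (\<Psi> v j)) + coeff_sum (excess (branch_factor (\<Psi> u) UNIV j))"
      unfolding prune_def using nb(2) norm(1)[of v j] normalized_branch_factor[OF pr]
      by (simp add: coeff_sum_excess_mult)
    then show "1 + coeff_sum (excess (?\<Psi> v j))
      = (1 + coeff_sum (excess (\<Psi> v j))) + (\<Sum>i\<in>{0..<X u}. ?p i j - 1)"
      using factor[OF j] by simp
  qed simp
  also have "\<dots> = (\<Sum>j\<in>{0..<X v}. 1 + coeff_sum (excess (\<Psi> v j)))
    + (\<Sum>j\<in>{0..<X v}. \<Sum>i\<in>{0..<X u}. ?p i j - 1)"
    by (rule sum.distrib)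
  also have "(\<Sum>j\<in>{0..<X v}. \<Sum>i\<in>{0..<X u}. ?p i j - 1)
    = (\<Sum>i\<in>{0..<X u}. \<Sum>j\<in>{0..<X v}. ?p i j) - of_int (X u * X v)"
    using X by (subst sum.swap) (simp add: sum_subtractf)
  finally have v: "(\<Sum>j\<in>{0..<X v}. 1 + coeff_sum (excess (?\<Psi> v j)))
    = (\<Sum>j\<in>{0..<X v}. 1 + coeff_sum (excess (\<Psi> v j)))
      + ((\<Sum>i\<in>{0..<X u}. \<Sum>j\<in>{0..<X v}. ?p i j) - of_int (X u * X v))" .
  have rest: "(\<Sum>w\<in>S - {v}. \<Sum>j\<in>{0..<X w}. 1 + coeff_sum (excess (?\<Psi> w j)))
    = (\<Sum>w\<in>S - {v}. \<Sum>j\<in>{0..<X w}. 1 + coeff_sum (excess (\<Psi> w j)))"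
    by (rule sum.cong) (auto simp: prune_def)
  have vertices: "(\<Sum>w\<in>S. \<Sum>j\<in>{0..<X w}. 1 + coeff_sum (excess (?\<Psi> w j)))
    = (\<Sum>w\<in>S. \<Sum>j\<in>{0..<X w}. 1 + coeff_sum (excess (\<Psi> w j)))
      + ((\<Sum>i\<in>{0..<X u}. \<Sum>j\<in>{0..<X v}. ?p i j) - of_int (X u * X v))"
    unfolding sum.remove[OF finite nb(2)] rest v by simp
  have e: "neighbour_sum ?S X w = neighbour_sum S X w + (if w = v then X u else 0)" if "w \<in> S" for w
    using that nbs(2)[of X "X u"] nbs(3)[of w X "X u"] by auto
  have "(\<Sum>w\<in>S. X w * neighbour_sum ?S X w) = (\<Sum>w\<in>S. X w * neighbour_sum S X w + (if w = v then X v * X u else 0))"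
    by (rule sum.cong) (auto simp: e algebra_simps)
  also have "\<dots> = (\<Sum>w\<in>S. X w * neighbour_sum S X w) + X v * X u"
    using nb(2) by (simp add: sum.distrib)
  finally have edges: "(\<Sum>w\<in>?S. X w * neighbour_sum ?S X w) = (\<Sum>w\<in>S. X w * neighbour_sum S X w) + 2 * (X u * X v)"
    using nb(1) nbs(1)[of X] by simp
  show ?case
    unfolding step IH vertices edges sum.insert[OF finite nb(1)]
    by (simp add: add_divide_distrib)
qed

end

section \<open>The lattice of a plumbing tree\<close>

locale plumbing_tree =
  fixes \<Gamma> :: "'v::finite plumbing_graph"
  assumes plumbing: "plumbing_graph \<Gamma>" and tree: "tree_graph \<Gamma>"
    and negdef: "negative_definite \<Gamma>"
begin

sublocale finite_graph "adj \<Gamma>"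
  using plumbing by unfold_locales (auto simp: plumbing_graph_def symp_def irreflp_def)

text \<open>
  This is the intersection number \<open>(x, E\<^sub>v)\<close>, written so that the neighbours of \<open>v\<close> are visible.
\<close>

definition pairing :: "rat ^ 'v \<Rightarrow> 'v \<Rightarrow> rat" where
  "pairing x v = of_int (euler \<Gamma> v) * x $ v + (\<Sum>w\<in>neighbours UNIV v. x $ w)"

lemma card_neighbours: "card (neighbours UNIV v) = valency \<Gamma> v"
  by (simp add: neighbours_def valency_def)

lemma iform_eq_pairing: "iform \<Gamma> x y = (\<Sum>v\<in>UNIV. pairing x v * y $ v)"
proof -
  have "iform \<Gamma> x y = (\<Sum>w\<in>UNIV. (\<Sum>v\<in>UNIV. x $ v * of_int (intersection_number \<Gamma> v w)) * y $ w)"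
    unfolding iform_def by (subst sum.swap) (simp add: sum_distrib_right)
  moreover have "(\<Sum>v\<in>UNIV. x $ v * of_int (intersection_number \<Gamma> v w)) = pairing x w" for w
  proof -
    have nb: "neighbours UNIV w \<subseteq> UNIV - {w}" using adj_irrefl by (auto simp: neighbours_def)
    have "(\<Sum>v\<in>UNIV. x $ v * of_int (intersection_number \<Gamma> v w))
      = x $ w * of_int (euler \<Gamma> w) + (\<Sum>v\<in>UNIV - {w}. x $ v * of_int (intersection_number \<Gamma> v w))"
      by (subst sum.remove[of UNIV w]) (simp_all add: intersection_number_def)
    also have "(\<Sum>v\<in>UNIV - {w}. x $ v * of_int (intersection_number \<Gamma> v w))
      = (\<Sum>v\<in>neighbours UNIV w. x $ v * of_int (intersection_number \<Gamma> v w))"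
      by (rule sum.mono_neutral_right[OF _ nb])
        (use adj_sym in \<open>auto simp: neighbours_def intersection_number_def\<close>)
    also have "\<dots> = (\<Sum>v\<in>neighbours UNIV w. x $ v)"
      by (rule sum.cong) (use nb adj_sym in \<open>auto simp: neighbours_def intersection_number_def\<close>)
    finally show ?thesis by (simp add: pairing_def mult.commute)
  qed
  ultimately show ?thesis by simp
qed

lemma iform_axis: "iform \<Gamma> x (axis v 1) = pairing x v"
  unfolding iform_eq_pairing axis_def by (simp add: if_distrib cong: if_cong)

lemma pairing_add: "pairing (x + y) v = pairing x v + pairing y v"
  by (simp add: pairing_def sum.distrib algebra_simps)

lemma pairing_scale: "pairing (c *s x) v = c * pairing x v"
  by (simp add: pairing_def sum_distrib_left algebra_simps)

lemma pairing_minus: "pairing (- x) v = - pairing x v"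
  by (simp add: pairing_def sum_negf)

lemma pairing_diff: "pairing (x - y) v = pairing x v - pairing y v"
  by (simp add: pairing_def sum_subtractf algebra_simps)

lemma pairing_zero: "pairing 0 v = 0"
  by (simp add: pairing_def)

lemma pairing_sum: "pairing (\<Sum>i\<in>I. f i) v = (\<Sum>i\<in>I. pairing (f i) v)"
  by (induction I rule: infinite_finite_induct) (simp_all add: pairing_zero pairing_add)

text \<open>
  The negative part \<open>u\<close> of \<open>t\<close> pairs with \<open>E\<^sub>w\<close> at most as much as \<open>t\<close> does wherever \<open>t\<close> is negative, because
  distinct base vectors pair nonnegatively.  Hence \<open>(u, u) \<ge> 0\<close>, so \<open>u = 0\<close> by negative definiteness.
\<close>

lemma nonneg_if_pairing_nonpos:
  assumes "\<And>w. t $ w < 0 \<Longrightarrow> pairing t w \<le> 0"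
  shows "0 \<le> t $ w"
proof -
  define u where "u = (\<chi> w. min (t $ w) 0)"
  have "0 \<le> pairing u w * u $ w" for w
  proof (cases "t $ w < 0")
    case True
    have "pairing u w \<le> pairing t w"
      unfolding pairing_def by (intro add_mono sum_mono) (use True in \<open>simp_all add: u_def\<close>)
    then have "pairing u w \<le> 0" using assms[OF True] by linarith
    then show ?thesis using True by (simp add: u_def mult_nonpos_nonpos)
  qed (simp add: u_def)
  then have "0 \<le> iform \<Gamma> u u" unfolding iform_eq_pairing by (intro sum_nonneg) simp
  then have "u = 0" using negdef unfolding negative_definite_def by (metis not_less)
  then have "u $ w = 0" by simp
  then show ?thesis by (simp add: u_def)
qed

lemma connected_closed_UNIV:
  assumes "v \<in> C" and "\<And>x y. x \<in> C \<Longrightarrow> adj \<Gamma> x y \<Longrightarrow> y \<in> C"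
  shows "C = UNIV"
proof -
  have "y \<in> C" if "(adj \<Gamma>)\<^sup>*\<^sup>* v y" for y
    using that by (induction rule: rtranclp_induct) (use assms in auto)
  then show ?thesis using tree unfolding tree_graph_def connected_graph_def by blast
qed

text \<open>
  A zero of \<open>t\<close> propagates to all neighbours, as in the maximum principle.
\<close>

lemma zero_if_pairing_nonpos:
  assumes nonneg: "\<And>w. 0 \<le> t $ w" and "\<And>w. t $ w = 0 \<Longrightarrow> pairing t w \<le> 0" and "t $ v = 0"
  shows "t $ w = 0"
proof -
  have "{w. t $ w = 0} = UNIV"
  proof (rule connected_closed_UNIV)
    show "v \<in> {w. t $ w = 0}" using assms(3) by simp
    fix x y assume x: "x \<in> {w. t $ w = 0}" and "adj \<Gamma> x y"
    have "(\<Sum>w\<in>neighbours UNIV x. t $ w) \<le> 0" using assms(2)[of x] x by (simp add: pairing_def)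
    then have "(\<Sum>w\<in>neighbours UNIV x. t $ w) = 0" using sum_nonneg[of "neighbours UNIV x" "\<lambda>w. t $ w"] nonneg by force
    then have "\<forall>w\<in>neighbours UNIV x. t $ w = 0" using nonneg by (simp add: sum_nonneg_eq_0_iff)
    then show "y \<in> {w. t $ w = 0}" using \<open>adj \<Gamma> x y\<close> by (simp add: neighbours_def)
  qed
  then show ?thesis by blast
qed

lemma pairing_inject:
  assumes "\<And>w. pairing x w = pairing y w"
  shows "x = y"
proof -
  have "iform \<Gamma> (x - y) (x - y) = 0"
    unfolding iform_eq_pairing by (simp add: pairing_diff assms)
  then show ?thesis using negdef unfolding negative_definite_def by (metis eq_iff_diff_eq_0 less_irrefl)
qed

lemma pairing_surj: "\<exists>x. \<forall>w. pairing x w = b w"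
proof -
  let ?f = "\<lambda>x. \<chi> w. pairing x w"
  have "Vector_Spaces.linear (*s) (*s) ?f"
    by unfold_locales (simp_all add: vec_eq_iff pairing_add pairing_scale)
  moreover have "inj ?f" by (rule injI, rule pairing_inject) (simp add: vec_eq_iff)
  ultimately have "surj ?f" by (rule vec.linear_inj_imp_surj)
  then obtain x where "(\<chi> w. b w) = ?f x" by (rule surjE)
  then show ?thesis by (metis vec_lambda_beta)
qed

lemma pairing_ex1: "\<exists>!x. \<forall>w. pairing x w = b w"
  using pairing_surj[of b] by (auto intro: pairing_inject)

lemma pairing_E_dual: "pairing (E_dual \<Gamma> v) w = (if v = w then - 1 else 0)"
  unfolding E_dual_def iform_axis
  using theI'[OF pairing_ex1[of "\<lambda>w. if v = w then - 1 else 0"]] by blast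

lemma pairing_Z_K: "pairing (Z_K \<Gamma>) v = of_int (euler \<Gamma> v) + 2"
proof -
  have e: "pairing (axis v 1) v = of_int (euler \<Gamma> v)" for v
    unfolding pairing_def using adj_irrefl by (auto simp: axis_def neighbours_def intro!: sum.neutral)
  show ?thesis
    unfolding Z_K_def iform_axis
    using theI'[OF pairing_ex1[of "\<lambda>v. pairing (axis v 1) v + 2"]] e by metis
qed

lemma sum_E_dual: "x = (\<Sum>v\<in>UNIV. (- pairing x v) *s E_dual \<Gamma> v)"
proof (rule pairing_inject)
  fix w
  have "pairing (\<Sum>v\<in>UNIV. (- pairing x v) *s E_dual \<Gamma> v) w
    = (\<Sum>v\<in>UNIV. if v = w then pairing x v else 0)"
    unfolding pairing_sum pairing_scale by (rule sum.cong) (simp_all add: pairing_E_dual)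
  then show "pairing x w = pairing (\<Sum>v\<in>UNIV. (- pairing x v) *s E_dual \<Gamma> v) w" by simp
qed

text \<open>
  Together with \<open>sum_E_dual\<close> this bounds all exponents \<open>k\<^sub>v\<close> of a point in the support by any one of its
  coordinates.
\<close>

lemma E_dual_pos: "0 < E_dual \<Gamma> v $ w"
proof -
  have nonneg: "0 \<le> E_dual \<Gamma> v $ w" for w
    by (rule nonneg_if_pairing_nonpos) (simp add: pairing_E_dual)
  have "E_dual \<Gamma> v $ w \<noteq> 0"
  proof
    assume "E_dual \<Gamma> v $ w = 0"
    then have "E_dual \<Gamma> v $ x = 0" for x
      using zero_if_pairing_nonpos[OF nonneg] by (simp add: pairing_E_dual)
    then have "E_dual \<Gamma> v = 0" by (simp add: vec_eq_iff)
    then show False using pairing_E_dual[of v v] by (simp add: pairing_zero)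
  qed
  then show ?thesis using nonneg[of w] by simp
qed

definition ivec :: "('v \<Rightarrow> int) \<Rightarrow> rat ^ 'v" where
  "ivec n = (\<chi> w. of_int (n w))"

lemma ivec_nth [simp]: "ivec n $ w = of_int (n w)"
  by (simp add: ivec_def)

lemma pairing_ivec: "pairing (ivec n) w = of_int (euler \<Gamma> w * n w + neighbour_sum UNIV n w)"
  by (simp add: pairing_def neighbour_sum_def)

lemma L_lattice_eq: "L_lattice = range ivec"
proof
  show "L_lattice \<subseteq> range ivec"
  proof
    fix x :: "rat ^ 'v" assume "x \<in> L_lattice"
    then have "x = ivec (\<lambda>w. \<lfloor>x $ w\<rfloor>)" by (simp add: vec_eq_iff L_lattice_def)
    then show "x \<in> range ivec" by blast
  qed
qed (auto simp: L_lattice_def)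

lemma L_dual_iff: "x \<in> L_dual \<Gamma> \<longleftrightarrow> (\<forall>w. pairing x w \<in> \<int>)"
proof
  assume x: "x \<in> L_dual \<Gamma>"
  show "\<forall>w. pairing x w \<in> \<int>"
  proof
    fix w
    have "axis w 1 \<in> (L_lattice :: (rat ^ 'v) set)" by (simp add: L_lattice_def axis_def)
    then show "pairing x w \<in> \<int>" using x unfolding L_dual_def iform_axis[symmetric] by blast
  qed
qed (auto simp: L_dual_def iform_eq_pairing L_lattice_def intro!: Ints_sum Ints_mult)

lemma L_lattice_subset: "L_lattice \<subseteq> L_dual \<Gamma>"
  by (auto simp: L_lattice_eq L_dual_iff pairing_ivec)

lemma Z_K_in_L_dual: "Z_K \<Gamma> \<in> L_dual \<Gamma>"
  by (simp add: L_dual_iff pairing_Z_K)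

lemma L_dual_minus: "x \<in> L_dual \<Gamma> \<Longrightarrow> - x \<in> L_dual \<Gamma>"
  by (simp add: L_dual_iff pairing_minus)

lemma L_dual_add: "x \<in> L_dual \<Gamma> \<Longrightarrow> y \<in> L_dual \<Gamma> \<Longrightarrow> x + y \<in> L_dual \<Gamma>"
  by (simp add: L_dual_iff pairing_add)

lemma L_dual_diff: "x \<in> L_dual \<Gamma> \<Longrightarrow> y \<in> L_dual \<Gamma> \<Longrightarrow> x - y \<in> L_dual \<Gamma>"
  by (simp add: L_dual_iff pairing_diff)

lemma comm_group_L_dual: "comm_group (L_dual_group \<Gamma>)"
proof (rule comm_groupI)
  fix x assume "x \<in> carrier (L_dual_group \<Gamma>)"
  then show "\<exists>y\<in>carrier (L_dual_group \<Gamma>). y \<otimes>\<^bsub>L_dual_group \<Gamma>\<^esub> x = \<one>\<^bsub>L_dual_group \<Gamma>\<^esub>"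
    by (intro bexI[of _ "- x"]) (simp_all add: L_dual_group_def L_dual_minus)
qed (simp_all add: L_dual_group_def L_dual_add add_ac, simp add: L_dual_iff pairing_zero)

lemma inv_L_dual:
  assumes "x \<in> L_dual \<Gamma>"
  shows "inv\<^bsub>L_dual_group \<Gamma>\<^esub> x = - x"
proof -
  interpret comm_group "L_dual_group \<Gamma>" by (rule comm_group_L_dual)
  show ?thesis
    by (rule inv_equality) (use assms L_dual_minus in \<open>simp_all add: L_dual_group_def\<close>)
qed

lemma L_lattice_normal: "L_lattice \<lhd> L_dual_group \<Gamma>"
proof -
  interpret comm_group "L_dual_group \<Gamma>" by (rule comm_group_L_dual)
  have "subgroup L_lattice (L_dual_group \<Gamma>)"
  proof
    show "L_lattice \<subseteq> carrier (L_dual_group \<Gamma>)" using L_lattice_subset by (simp add: L_dual_group_def)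
    fix x y :: "rat ^ 'v" assume x: "x \<in> L_lattice"
    have "x \<in> L_dual \<Gamma>" using x L_lattice_subset by blast
    then show "inv\<^bsub>L_dual_group \<Gamma>\<^esub> x \<in> L_lattice" using x by (simp add: inv_L_dual) (simp add: L_lattice_def)
    assume "y \<in> L_lattice"
    then show "x \<otimes>\<^bsub>L_dual_group \<Gamma>\<^esub> y \<in> L_lattice" using x by (simp add: L_dual_group_def L_lattice_def)
  qed (simp add: L_dual_group_def L_lattice_def)
  then show ?thesis by (rule subgroup_imp_normal)
qed

lemma carrier_H_group: "carrier (H_group \<Gamma>) = H_class \<Gamma> ` L_dual \<Gamma>"
  unfolding H_group_def carrier_FactGroup H_class_def by (simp add: L_dual_group_def)

lemma mult_H_class:
  assumes "x \<in> L_dual \<Gamma>" and "y \<in> L_dual \<Gamma>"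
  shows "H_class \<Gamma> x \<otimes>\<^bsub>H_group \<Gamma>\<^esub> H_class \<Gamma> y = H_class \<Gamma> (x + y)"
  unfolding H_group_def mult_FactGroup H_class_def
  using normal.rcos_sum[OF L_lattice_normal, of x y] assms by (simp add: L_dual_group_def)

lemma inv_H_class:
  assumes "x \<in> L_dual \<Gamma>"
  shows "inv\<^bsub>H_group \<Gamma>\<^esub> (H_class \<Gamma> x) = H_class \<Gamma> (- x)"
proof -
  have "H_class \<Gamma> x \<in> carrier (L_dual_group \<Gamma> Mod L_lattice)"
    using assms carrier_H_group by (auto simp: H_group_def)
  then have "inv\<^bsub>H_group \<Gamma>\<^esub> (H_class \<Gamma> x) = set_inv\<^bsub>L_dual_group \<Gamma>\<^esub> (H_class \<Gamma> x)"
    unfolding H_group_def by (rule normal.inv_FactGroup[OF L_lattice_normal])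
  also have "\<dots> = H_class \<Gamma> (inv\<^bsub>L_dual_group \<Gamma>\<^esub> x)"
    unfolding H_class_def by (rule normal.rcos_inv[OF L_lattice_normal]) (use assms in \<open>simp add: L_dual_group_def\<close>)
  finally show ?thesis by (simp add: inv_L_dual[OF assms])
qed

lemma mem_H_class_iff: "y \<in> H_class \<Gamma> x \<longleftrightarrow> (\<exists>n. y = x + ivec n)"
  unfolding H_class_def r_coset_def L_dual_group_def L_lattice_eq by (auto simp: add.commute)

lemma H_class_eq_iff: "H_class \<Gamma> y = H_class \<Gamma> x \<longleftrightarrow> (\<exists>n. y = x + ivec n)"
proof
  assume "H_class \<Gamma> y = H_class \<Gamma> x"
  moreover have "y \<in> H_class \<Gamma> y" unfolding mem_H_class_iff by (intro exI[of _ "\<lambda>_. 0"]) (simp add: vec_eq_iff)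
  ultimately show "\<exists>n. y = x + ivec n" by (simp add: mem_H_class_iff)
next
  assume "\<exists>n. y = x + ivec n"
  then obtain n where n: "y = x + ivec n" by blast
  have "(\<exists>m. z = x + ivec n + ivec m) \<longleftrightarrow> (\<exists>m. z = x + ivec m)" for z
  proof
    assume "\<exists>m. z = x + ivec n + ivec m"
    then obtain m where "z = x + ivec n + ivec m" by blast
    then have "z = x + ivec (\<lambda>w. n w + m w)" by (simp add: vec_eq_iff)
    then show "\<exists>m. z = x + ivec m" by blast
  next
    assume "\<exists>m. z = x + ivec m"
    then obtain m where "z = x + ivec m" by blast
    then have "z = x + ivec n + ivec (\<lambda>w. m w - n w)" by (simp add: vec_eq_iff)
    then show "\<exists>m. z = x + ivec n + ivec m" by blast
  qed
  then show "H_class \<Gamma> y = H_class \<Gamma> x" by (simp add: set_eq_iff mem_H_class_iff n)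
qed

text \<open>
  The representative exists by taking fractional parts, and is unique because integral vectors with
  coordinates of absolute value less than \<open>1\<close> vanish.
\<close>

lemma r_rep_properties:
  assumes "h \<in> carrier (H_group \<Gamma>)"
  shows "r_rep h \<in> L_dual \<Gamma>" and "h = H_class \<Gamma> (r_rep h)" and "0 \<le> r_rep h $ v" and "r_rep h $ v < 1"
proof -
  obtain x where x: "x \<in> L_dual \<Gamma>" "h = H_class \<Gamma> x" using assms by (auto simp: carrier_H_group)
  have "\<exists>!r. r \<in> h \<and> (\<forall>v. 0 \<le> r $ v \<and> r $ v < 1)"
  proof (rule ex_ex1I)
    have "(\<chi> v. frac (x $ v)) = x + ivec (\<lambda>v. - \<lfloor>x $ v\<rfloor>)" by (simp add: vec_eq_iff frac_def)
    then have "(\<chi> v. frac (x $ v)) \<in> h" unfolding x(2) mem_H_class_iff by blast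
    then show "\<exists>r. r \<in> h \<and> (\<forall>v. 0 \<le> r $ v \<and> r $ v < 1)"
      by (intro exI[of _ "\<chi> v. frac (x $ v)"]) (simp add: frac_lt_1)
  next
    fix r r' assume r: "r \<in> h \<and> (\<forall>v. 0 \<le> r $ v \<and> r $ v < 1)" and r': "r' \<in> h \<and> (\<forall>v. 0 \<le> r' $ v \<and> r' $ v < 1)"
    then obtain n n' where n: "r = x + ivec n" "r' = x + ivec n'" unfolding x(2) mem_H_class_iff by blast
    have "n v = n' v" for v
    proof -
      have "0 \<le> r $ v" "r $ v < 1" "0 \<le> r' $ v" "r' $ v < 1" using r r' by blast+
      then have "\<bar>r $ v - r' $ v\<bar> < 1" by linarith
      then have "\<bar>of_int (n v - n' v) :: rat\<bar> < 1" by (simp add: n)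
      then show ?thesis by linarith
    qed
    then show "r = r'" by (simp add: n vec_eq_iff)
  qed
  from theI'[OF this] have r: "r_rep h \<in> h" "\<forall>v. 0 \<le> r_rep h $ v \<and> r_rep h $ v < 1"
    unfolding r_rep_def by blast+
  then obtain n where n: "r_rep h = x + ivec n" unfolding x(2) mem_H_class_iff by blast
  then show "r_rep h \<in> L_dual \<Gamma>" using x(1) L_lattice_subset by (simp add: L_dual_add L_lattice_eq image_subset_iff)
  have "H_class \<Gamma> (r_rep h) = H_class \<Gamma> x" unfolding H_class_eq_iff using n by blast
  then show "h = H_class \<Gamma> (r_rep h)" using x(2) by (rule trans[OF _ sym, rotated])
  show "0 \<le> r_rep h $ v" "r_rep h $ v < 1" using r(2) by blast+
qed

lemma subtree_path:
  assumes "subtree r S" and "a \<in> S" and "b \<in> S"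
  shows "\<exists>p. p \<noteq> [] \<and> distinct p \<and> successively (adj \<Gamma>) p \<and> hd p = a \<and> last p = b \<and> set p \<subseteq> S"
  using assms
proof (induction arbitrary: a b rule: subtree.induct)
  case root
  then show ?case by (intro exI[of _ "[r]"]) simp
next
  case (grow S u v)
  note nb = pendant_neighbours[OF grow.hyps(2)]
  have uv: "adj \<Gamma> u v" using grow.hyps(2) by (auto simp: pendant_def neighbours_def)
  consider "a \<in> S" "b \<in> S" | "a = u" "b = u" | "a = u" "b \<in> S" | "a \<in> S" "b = u"
    using grow.prems by blast
  then show ?case
  proof cases
    case 1
    then show ?thesis using grow.IH[of a b] by blast
  next
    case 2
    then show ?thesis by (intro exI[of _ "[u]"]) simp
  next
    case 3
    then obtain p where p: "p \<noteq> []" "distinct p" "successively (adj \<Gamma>) p" "hd p = v" "last p = b" "set p \<subseteq> S"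
      using grow.IH[of v b] nb(2) by blast
    then show ?thesis using 3 nb(1) uv
      by (intro exI[of _ "u # p"]) (auto simp: successively_Cons)
  next
    case 4
    then obtain p where p: "p \<noteq> []" "distinct p" "successively (adj \<Gamma>) p" "hd p = a" "last p = v" "set p \<subseteq> S"
      using grow.IH[of a v] nb(2) by blast
    then show ?thesis using 4 nb(1) adj_sym[OF uv]
      by (intro exI[of _ "p @ [u]"]) (auto simp: successively_append_iff)
  qed
qed

text \<open>
  Connectivity gives an edge leaving \<open>S\<close>.  A second edge from its outer end \<open>u\<close> to \<open>S\<close> would close a cycle with a
  path inside \<open>S\<close>.
\<close>

lemma subtree_extend:
  assumes sub: "subtree r S" and "S \<noteq> UNIV"
  obtains u v where "pendant S u v"
proof -
  have "r \<in> S" using sub by (induction rule: subtree.induct) auto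
  then obtain v u where uv: "v \<in> S" "adj \<Gamma> v u" "u \<notin> S"
    using connected_closed_UNIV[of r S] \<open>S \<noteq> UNIV\<close> by blast
  have "w = v" if w: "w \<in> S" "adj \<Gamma> u w" for w
  proof (rule ccontr)
    assume "w \<noteq> v"
    obtain p where p: "p \<noteq> []" "distinct p" "successively (adj \<Gamma>) p" "hd p = w" "last p = v" "set p \<subseteq> S"
      using subtree_path[OF sub w(1) uv(1)] by blast
    have "length p \<noteq> 1" using p(1,4,5) \<open>w \<noteq> v\<close> by (cases p) auto
    then have "2 \<le> length p" using p(1) by (cases p) (auto simp: Suc_le_eq)
    moreover have "u \<notin> set p" using p(6) uv(3) by blast
    moreover have "successively (adj \<Gamma>) (u # p)"
      using p(1,3) w(2) unfolding successively_Cons p(4) by blast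
    moreover have "adj \<Gamma> (last (u # p)) (hd (u # p))" using p(1,5) uv(2) by simp
    ultimately have "cycle_in \<Gamma> (u # p)" using p(2) unfolding cycle_in_def by simp
    then show False using tree unfolding tree_graph_def by blast
  qed
  then have "neighbours S u = {v}" using uv(1) adj_sym[OF uv(2)] unfolding neighbours_def by blast
  then show thesis using that uv(3) by (simp add: pendant_def)
qed

lemma subtree_UNIV: "subtree r UNIV"
proof -
  have "\<exists>S. subtree r S \<and> (\<forall>T. subtree r T \<longrightarrow> card T \<le> card S)"
  proof (rule ex_has_greatest_nat[of "subtree r" "{r}" card "Suc CARD('v)"])
    show "\<forall>T. subtree r T \<longrightarrow> card T < Suc CARD('v)" by (simp add: less_Suc_eq_le card_mono)
  qed (rule subtree.root)
  (* A subtree of maximal size is everything, by the previous lemma. *)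
  then obtain S where S: "subtree r S" "\<And>T. subtree r T \<Longrightarrow> card T \<le> card S" by blast
  have "S = UNIV"
  proof (rule ccontr)
    assume "S \<noteq> UNIV"
    then obtain u v where "pendant S u v" using subtree_extend[OF S(1)] by blast
    then have "card (insert u S) \<le> card S" and "u \<notin> S"
      using S(2)[OF subtree.grow[OF S(1)]] by (blast, simp add: pendant_def)
    then show False by simp
  qed
  then show ?thesis using S(1) by (rule subst)
qed

section \<open>Series coefficients as weights\<close>

text \<open>
  For \<open>b \<in> L'\<close> this is the integer \<open>(b + j E\<^sub>w, E\<^sub>w)\<close>.
\<close>

definition self_exponent :: "rat ^ 'v \<Rightarrow> 'v \<Rightarrow> int \<Rightarrow> int" where
  "self_exponent b w j = \<lfloor>pairing b w\<rfloor> + euler \<Gamma> w * j"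

definition monomials :: "rat ^ 'v \<Rightarrow> 'v \<Rightarrow> int \<Rightarrow> rat fls" where
  "monomials b w j = fls_shift (- self_exponent b w j) 1"

lemma monomials_nth: "monomials b w j $$ m = (if m = self_exponent b w j then 1 else 0)"
  by (simp add: monomials_def)

lemma pairing_add_ivec:
  assumes "b \<in> L_dual \<Gamma>"
  shows "pairing (b + ivec n) w = of_int (self_exponent b w (n w) + neighbour_sum UNIV n w)"
proof -
  have "pairing b w = of_int \<lfloor>pairing b w\<rfloor>" using assms by (simp add: L_dual_iff)
  then show ?thesis by (simp add: pairing_add pairing_ivec self_exponent_def)
qed

lemma add_ivec_in_L_dual: "b \<in> L_dual \<Gamma> \<Longrightarrow> b + ivec n \<in> L_dual \<Gamma>"
  using L_lattice_subset by (simp add: L_dual_add L_lattice_eq image_subset_iff)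

text \<open>
  Pairing with the base vectors recovers the exponents from their lattice point, so there is one
  exponent vector or none, depending on the signs of the \<open>\<kappa> w\<close>.
\<close>

lemma z_coeff_eq:
  assumes "\<And>w. - pairing x w = of_int (\<kappa> w)"
  shows "z_coeff \<Gamma> x = (\<Prod>w\<in>UNIV. ((1 - fls_X) powi (int (valency \<Gamma> w) - 2)) $$ \<kappa> w)"
proof -
  let ?K = "{k. (\<Sum>v\<in>UNIV. of_nat (k v) *s E_dual \<Gamma> v) = x}"
  have K: "k \<in> ?K \<longleftrightarrow> (\<forall>w. int (k w) = \<kappa> w)" for k
  proof -
    have p: "pairing (\<Sum>v\<in>UNIV. of_nat (k v) *s E_dual \<Gamma> v) w = - of_nat (k w)" for w
    proof -
      have "pairing (\<Sum>v\<in>UNIV. of_nat (k v) *s E_dual \<Gamma> v) w = (\<Sum>v\<in>UNIV. if v = w then - of_nat (k v) else 0)"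
        unfolding pairing_sum pairing_scale by (rule sum.cong) (simp_all add: pairing_E_dual)
      then show ?thesis by simp
    qed
    have "k \<in> ?K \<longleftrightarrow> (\<forall>w. - of_nat (k w) = pairing x w)"
    proof
      assume "k \<in> ?K"
      then show "\<forall>w. - of_nat (k w) = pairing x w" using p by simp
    next
      assume "\<forall>w. - of_nat (k w) = pairing x w"
      then have "(\<Sum>v\<in>UNIV. of_nat (k v) *s E_dual \<Gamma> v) = x" using p by (intro pairing_inject) simp
      then show "k \<in> ?K" by simp
    qed
    also have "\<dots> \<longleftrightarrow> (\<forall>w. (of_int (int (k w)) :: rat) = of_int (\<kappa> w))"
    proof -
      have "- of_nat (k w) = pairing x w \<longleftrightarrow> (of_int (int (k w)) :: rat) = of_int (\<kappa> w)" for w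
        unfolding assms[symmetric] of_int_of_nat_eq by (intro iffI; linarith)
      then show ?thesis by blast
    qed
    finally show ?thesis by (simp only: of_int_eq_iff)
  qed
  show ?thesis
  proof (cases "\<forall>w. 0 \<le> \<kappa> w")
    case True
    have "?K = {\<lambda>w. nat (\<kappa> w)}"
    proof (rule Set.set_eqI)
      fix k
      have "int (k w) = \<kappa> w \<longleftrightarrow> k w = nat (\<kappa> w)" for w using True by (auto simp: nat_eq_iff2)
      then show "k \<in> ?K \<longleftrightarrow> k \<in> {\<lambda>w. nat (\<kappa> w)}" unfolding K by (auto simp: fun_eq_iff)
    qed
    then show ?thesis unfolding z_coeff_def using True by (simp add: one_minus_fls_X_powi_nth)
  next
    case False
    then obtain w where w: "\<kappa> w < 0" using not_le by blast
    have "k \<notin> ?K" for k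
    proof
      assume "k \<in> ?K"
      then have "int (k w) = \<kappa> w" unfolding K by blast
      then show False using w by simp
    qed
    then have "?K = {}" by blast
    moreover have "(\<Prod>w\<in>UNIV. ((1 - fls_X :: rat fls) powi (int (valency \<Gamma> w) - 2)) $$ \<kappa> w) = 0"
      by (rule prod_zero[OF finite bexI[of _ w]]) (use w in \<open>simp_all add: one_minus_fls_X_powi_nth\<close>)
    ultimately show ?thesis unfolding z_coeff_def by simp
  qed
qed

lemma z_coeff_nonzero_pairing:
  assumes "x \<in> L_dual \<Gamma>" and "z_coeff \<Gamma> x \<noteq> 0"
  shows "pairing x w \<le> 0"
proof (rule ccontr)
  assume "\<not> pairing x w \<le> 0"
  define \<kappa> where "\<kappa> w = - \<lfloor>pairing x w\<rfloor>" for w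
  have \<kappa>: "- pairing x w = of_int (\<kappa> w)" for w using assms(1) by (simp add: \<kappa>_def L_dual_iff)
  then have "(of_int (\<kappa> w) :: rat) < 0" using \<open>\<not> pairing x w \<le> 0\<close> \<kappa>[of w] by linarith
  then have "\<kappa> w < 0" by simp
  then have "(\<Prod>w\<in>UNIV. ((1 - fls_X :: rat fls) powi (int (valency \<Gamma> w) - 2)) $$ \<kappa> w) = 0"
    by (intro prod_zero[OF finite bexI[of _ w]]) (simp_all add: one_minus_fls_X_powi_nth)
  then show False using assms(2) z_coeff_eq[OF \<kappa>] by simp
qed

lemma weight_eq_z_coeff:
  assumes "b \<in> L_dual \<Gamma>"
  shows "weight UNIV (monomials b) n = z_coeff \<Gamma> (b + ivec n)"
proof -
  have "- pairing (b + ivec n) w = of_int (- neighbour_sum UNIV n w - self_exponent b w (n w))" for w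
    by (simp add: pairing_add_ivec[OF assms])
  note z_coeff_eq[of "b + ivec n" "\<lambda>w. - neighbour_sum UNIV n w - self_exponent b w (n w)", OF this]
  moreover have "vertex_series UNIV w (monomials b w (n w)) $$ (- neighbour_sum UNIV n w)
    = ((1 - fls_X) powi (int (valency \<Gamma> w) - 2)) $$ (- neighbour_sum UNIV n w - self_exponent b w (n w))" for w
    unfolding vertex_series_def monomials_def card_neighbours fls_X_intpow_times_conv_shift(2) by simp
  ultimately show ?thesis unfolding weight_def by simp
qed

lemma counting_sum_monomials:
  assumes "b \<in> L_dual \<Gamma>"
  shows "counting_sum UNIV (monomials b) X = Q_count \<Gamma> (H_class \<Gamma> b) UNIV (b + ivec X)"
  unfolding counting_sum_def Q_count_def
proof (rule sum.reindex_bij_witness[of _ "\<lambda>l w. \<lfloor>l $ w - b $ w\<rfloor>" "\<lambda>n. b + ivec n"])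
  fix n assume n: "n \<in> {n. n \<in> support UNIV (monomials b) \<and> (\<exists>w\<in>UNIV. n w < X w)}"
  show "(\<lambda>w. \<lfloor>(b + ivec n) $ w - b $ w\<rfloor>) = n" by simp
  show "z_coeff \<Gamma> (b + ivec n) = weight UNIV (monomials b) n" by (simp add: weight_eq_z_coeff[OF assms])
  have "H_class \<Gamma> (b + ivec n) = H_class \<Gamma> b" unfolding H_class_eq_iff by blast
  then show "b + ivec n \<in> {l. l \<in> L_dual \<Gamma> \<and> \<not> (\<forall>v\<in>UNIV. (b + ivec X) $ v \<le> l $ v) \<and> H_class \<Gamma> l = H_class \<Gamma> b \<and> z_coeff \<Gamma> l \<noteq> 0}"
    using n add_ivec_in_L_dual[OF assms] by (auto simp: support_def weight_eq_z_coeff[OF assms] not_le)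
next
  fix l assume l: "l \<in> {l. l \<in> L_dual \<Gamma> \<and> \<not> (\<forall>v\<in>UNIV. (b + ivec X) $ v \<le> l $ v) \<and> H_class \<Gamma> l = H_class \<Gamma> b \<and> z_coeff \<Gamma> l \<noteq> 0}"
  then have "H_class \<Gamma> l = H_class \<Gamma> b" by simp
  then obtain n where n: "l = b + ivec n" unfolding H_class_eq_iff by blast
  then have eq: "(\<lambda>w. \<lfloor>l $ w - b $ w\<rfloor>) = n" by simp
  show "b + ivec (\<lambda>w. \<lfloor>l $ w - b $ w\<rfloor>) = l" unfolding eq using n by simp
  show "(\<lambda>w. \<lfloor>l $ w - b $ w\<rfloor>) \<in> {n. n \<in> support UNIV (monomials b) \<and> (\<exists>w\<in>UNIV. n w < X w)}"
    unfolding eq using l by (auto simp: n support_def weight_eq_z_coeff[OF assms] not_le)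
qed

text \<open>
  Put \<open>t = (b + X - E + q) - (b + n)\<close>.  Since \<open>q\<close> has coordinates in \<open>[0, 1)\<close>, a coordinate of \<open>t\<close> is negative exactly where
  \<open>n\<close> reaches the bound, and there the hypotheses on \<open>n\<close> and on the cone bound \<open>(t, E\<^sub>w)\<close> by \<open>0\<close>,
  because \<open>(Z\<^sub>K - E, E\<^sub>w) = 2 - \<delta>\<^sub>w\<close>.
\<close>

lemma confining_monomials:
  assumes b: "b \<in> L_dual \<Gamma>" and q: "\<And>w. 0 \<le> q $ w" "\<And>w. q $ w < 1"
    and cone: "\<And>w. pairing (b + ivec X + q) w \<le> pairing (Z_K \<Gamma>) w"
  shows "confining UNIV (monomials b) X"
  unfolding confining_def
proof (intro allI impI)
  fix n :: "'v \<Rightarrow> int"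
  assume n: "\<forall>w\<in>UNIV. X w \<le> n w \<longrightarrow> (\<exists>m. monomials b w (n w) $$ m \<noteq> 0
    \<and> 2 \<le> m + neighbour_sum UNIV n w + int (card (neighbours UNIV w)))"
  define t where "t = b + ivec X + q - (b + ivec n) - ivec (\<lambda>_. 1)"
  have t: "t $ w = of_int (X w - n w) - 1 + q $ w" for w by (simp add: t_def)
  have "pairing t w \<le> 0" if "t $ w < 0" for w
  proof -
    have "(of_int (X w - n w) :: rat) < of_int 1" using that q(1)[of w] unfolding t by simp
    then have "X w \<le> n w" unfolding of_int_less_iff by simp
    then have "2 \<le> self_exponent b w (n w) + neighbour_sum UNIV n w + int (valency \<Gamma> w)"
      using n by (auto simp: monomials_nth card_neighbours split: if_splits)
    then have "(of_int 2 :: rat) \<le> of_int (self_exponent b w (n w) + neighbour_sum UNIV n w + int (valency \<Gamma> w))"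
      unfolding of_int_le_iff .
    moreover have "pairing (ivec (\<lambda>_. 1)) w = of_int (euler \<Gamma> w) + of_nat (valency \<Gamma> w)"
      by (simp add: pairing_ivec neighbour_sum_def card_neighbours)
    moreover have "pairing t w = pairing (b + ivec X + q) w - pairing (b + ivec n) w - pairing (ivec (\<lambda>_. 1)) w"
      by (simp only: t_def pairing_diff)
    ultimately show ?thesis
      using cone[of w] by (simp add: pairing_add_ivec[OF b] pairing_Z_K)
  qed
  then have nonneg: "0 \<le> t $ w" for w by (rule nonneg_if_pairing_nonpos)
  show "\<forall>w\<in>UNIV. n w < X w"
  proof
    fix w
    have "(0 :: rat) < of_int (X w - n w)" using nonneg[of w] q(2)[of w] unfolding t by linarith
    then show "n w < X w" by simp
  qed
qed

text \<open>
  Take the sum of all dual vectors, multiplied by a common denominator.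
\<close>

lemma exists_ample:
  obtains A :: "'v \<Rightarrow> int" where "\<And>v. 0 < A v" and "\<And>v. pairing (ivec A) v \<le> - 1"
proof -
  define s where "s = (\<Sum>v\<in>UNIV. E_dual \<Gamma> v)"
  have s: "0 < s $ w" for w unfolding s_def by (simp add: sum_pos E_dual_pos)
  have ps: "pairing s w = - 1" for w unfolding s_def pairing_sum by (simp add: pairing_E_dual)
  define D where "D = (\<Prod>v\<in>UNIV. snd (quotient_of (s $ v)))"
  have D: "0 < D" unfolding D_def by (intro prod_pos) (simp add: quotient_of_denom_pos')
  have int: "of_int D * s $ v \<in> \<int>" for v
  proof -
    let ?d = "\<lambda>v. snd (quotient_of (s $ v))"
    have "s $ v = of_int (fst (quotient_of (s $ v))) / of_int (?d v)"
      by (metis quotient_of_div prod.collapse)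
    then have "of_int (?d v) * s $ v = of_int (fst (quotient_of (s $ v)))"
      using quotient_of_denom_pos'[of "s $ v"] by (simp add: field_simps)
    moreover have "of_int D = (of_int (\<Prod>w\<in>UNIV - {v}. ?d w) :: rat) * of_int (?d v)"
      unfolding D_def by (subst prod.remove[of UNIV v]) simp_all
    ultimately have "of_int D * s $ v = of_int (\<Prod>w\<in>UNIV - {v}. ?d w) * of_int (fst (quotient_of (s $ v)))"
      by (simp add: mult.assoc)
    then show ?thesis by (simp only: Ints_mult Ints_of_int)
  qed
  define A where "A v = \<lfloor>of_int D * s $ v\<rfloor>" for v
  have A: "of_int (A v) = of_int D * s $ v" for v using int[of v] by (simp add: A_def)
  have "ivec A = of_int D *s s" by (simp add: vec_eq_iff A)
  then have "pairing (ivec A) v = - of_int D" for v by (simp add: pairing_scale ps)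
  moreover have "- of_int D \<le> (- 1 :: rat)" using D by simp
  moreover have "0 < A v" for v
  proof -
    have "(0 :: rat) < of_int (A v)" unfolding A using D s[of v] by simp
    then show ?thesis by simp
  qed
  ultimately show thesis using that by metis
qed

text \<open>
  Multiples of an ample vector are large in all coordinates and pair very negatively with all \<open>E\<^sub>w\<close>.
\<close>

lemma exists_deep: "\<exists>X :: 'v \<Rightarrow> int. \<forall>w. N \<le> X w \<and> 0 \<le> X w \<and> pairing (ivec X) w \<le> c w"
proof -
  obtain A :: "'v \<Rightarrow> int" where A: "\<And>v. 0 < A v" "\<And>v. pairing (ivec A) v \<le> - 1" using exists_ample by blast
  define k where "k = max \<bar>N\<bar> (Max (range (\<lambda>w. \<lceil>\<bar>c w\<bar>\<rceil>)))"
  have k0: "0 \<le> k" "N \<le> k" by (simp_all add: k_def)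
  have kc: "- of_int k \<le> c w" for w
  proof -
    have "\<lceil>\<bar>c w\<bar>\<rceil> \<le> Max (range (\<lambda>w. \<lceil>\<bar>c w\<bar>\<rceil>))" by (rule Max_ge) auto
    then have "\<lceil>\<bar>c w\<bar>\<rceil> \<le> k" unfolding k_def by (rule max.coboundedI2)
    then have "\<bar>c w\<bar> \<le> of_int k" by (simp add: ceiling_le_iff)
    then show ?thesis by linarith
  qed
  have "ivec (\<lambda>w. k * A w) = of_int k *s ivec A" by (simp add: vec_eq_iff)
  then have "pairing (ivec (\<lambda>w. k * A w)) w \<le> of_int k * (- 1)" for w
    using A(2)[of w] k0(1) by (simp only: pairing_scale) (intro mult_left_mono; simp)
  then have le: "pairing (ivec (\<lambda>w. k * A w)) w \<le> - of_int k" for w by simp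
  have kA: "k * 1 \<le> k * A w" for w using A(1)[of w] k0(1) by (intro mult_left_mono) auto
  show ?thesis
  proof (intro exI[of _ "\<lambda>w. k * A w"] allI conjI)
    show "N \<le> k * A w" "0 \<le> k * A w" for w using kA[of w] k0 by linarith+
    show "pairing (ivec (\<lambda>w. k * A w)) w \<le> c w" for w using le[of w] kc[of w] by linarith
  qed
qed

text \<open>
  One bounded coordinate bounds all exponents, since the exponents in the support are nonnegative and
  the dual vectors have positive coordinates.  The exponents determine the labelling.
\<close>

lemma finite_support_below:
  assumes b: "b \<in> L_dual \<Gamma>"
  shows "finite {n \<in> support UNIV (monomials b). \<exists>w\<in>UNIV. n w < M}"
proof -
  let ?A = "{n \<in> support UNIV (monomials b). \<exists>w\<in>UNIV. n w < M}"
  let ?\<kappa> = "\<lambda>n w. - (self_exponent b w (n w) + neighbour_sum UNIV n w)"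
  define C where "C = Max (range (\<lambda>(v, w). \<lceil>(b $ v + of_int M) / E_dual \<Gamma> w $ v\<rceil>))"
  have bound: "?\<kappa> n w \<in> {0..C}" if n: "n \<in> ?A" for n w
  proof -
    let ?l = "b + ivec n"
    have l: "?l \<in> L_dual \<Gamma>" by (rule add_ivec_in_L_dual[OF b])
    have "z_coeff \<Gamma> ?l \<noteq> 0" using n by (simp add: support_def weight_eq_z_coeff[OF b])
    then have p: "pairing ?l w \<le> 0" for w by (rule z_coeff_nonzero_pairing[OF l])
    have \<kappa>: "- pairing ?l w = of_int (?\<kappa> n w)" for w by (simp add: pairing_add_ivec[OF b])
    obtain v where v: "n v < M" using n by blast
    have "?l $ v = (\<Sum>u\<in>UNIV. (- pairing ?l u) * E_dual \<Gamma> u $ v)"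
      using arg_cong[OF sum_E_dual[of ?l], of "\<lambda>x. x $ v"] by (simp add: sum_component)
    also have "\<dots> \<ge> (- pairing ?l w) * E_dual \<Gamma> w $ v"
      by (rule member_le_sum[of w UNIV "\<lambda>u. (- pairing ?l u) * E_dual \<Gamma> u $ v"])
        (use p E_dual_pos in \<open>auto simp: less_imp_le mult_nonpos_nonneg\<close>)
    finally have "of_int (?\<kappa> n w) * E_dual \<Gamma> w $ v \<le> ?l $ v" using \<kappa> by simp
    moreover have "?l $ v \<le> b $ v + of_int M" using v by simp
    ultimately have "of_int (?\<kappa> n w) \<le> (b $ v + of_int M) / E_dual \<Gamma> w $ v"
      using E_dual_pos[of w v] by (simp add: pos_le_divide_eq)
    then have "?\<kappa> n w \<le> \<lceil>(b $ v + of_int M) / E_dual \<Gamma> w $ v\<rceil>"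
      by (simp add: le_ceiling_iff)
    also have "\<dots> \<le> C" unfolding C_def by (rule Max_ge) (auto intro!: image_eqI[of _ _ "(v, w)"])
    finally have "?\<kappa> n w \<le> C" .
    moreover have "(0 :: rat) \<le> of_int (?\<kappa> n w)" using p[of w] \<kappa>[of w] by linarith
    ultimately show ?thesis by simp
  qed
  have "?\<kappa> ` ?A \<subseteq> {f. \<forall>w. (w \<in> UNIV \<longrightarrow> f w \<in> {0..C}) \<and> (w \<notin> UNIV \<longrightarrow> f w = 0)}"
  proof (rule image_subsetI)
    fix n assume "n \<in> ?A"
    then have "\<forall>w. ?\<kappa> n w \<in> {0..C}" using bound by blast
    then show "?\<kappa> n \<in> {f. \<forall>w. (w \<in> UNIV \<longrightarrow> f w \<in> {0..C}) \<and> (w \<notin> UNIV \<longrightarrow> f w = 0)}" by blast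
  qed
  then have "finite (?\<kappa> ` ?A)" by (rule finite_subset) (rule finite_set_of_finite_funs; simp)
  moreover have "inj_on ?\<kappa> ?A"
  proof (rule inj_onI)
    fix n n' assume "?\<kappa> n = ?\<kappa> n'"
    then have "?\<kappa> n w = ?\<kappa> n' w" for w by metis
    then have "b + ivec n = b + ivec n'"
      by (intro pairing_inject) (simp only: pairing_add_ivec[OF b] neg_equal_iff_equal)
    then show "n = n'" by (simp add: vec_eq_iff fun_eq_iff)
  qed
  ultimately show ?thesis by (rule finite_imageD)
qed

lemma admissible_monomials:
  assumes b: "b \<in> L_dual \<Gamma>"
  shows "admissible UNIV (monomials b)"
  unfolding admissible_def
proof (intro conjI allI ballI)
  show "normalized (monomials b w j)" for w j by (simp add: monomials_def normalized_monomial)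
  show "cofinally_confining UNIV (monomials b)"
    unfolding cofinally_confining_def
  proof
    fix N
    obtain X where X: "\<forall>w. N \<le> X w \<and> 0 \<le> X w \<and> pairing (ivec X) w \<le> pairing (Z_K \<Gamma>) w - pairing b w"
      using exists_deep ..
    have "confining UNIV (monomials b) X"
    proof (rule confining_monomials[OF b, of 0])
      show "pairing (b + ivec X + 0) w \<le> pairing (Z_K \<Gamma>) w" for w
        using spec[OF X, of w] by (simp add: pairing_add)
    qed simp_all
    then show "\<exists>X. (\<forall>w\<in>UNIV. N \<le> X w) \<and> confining UNIV (monomials b) X" using X by blast
  qed
  show "finite {n \<in> support UNIV (monomials b). \<exists>w\<in>UNIV. n w < M}" for M
    by (rule finite_support_below[OF b])
qed

text \<open>
  By definition of \<open>Z\<^sub>K\<close>, \<open>(Z\<^sub>K - b - (1 + j) E\<^sub>w, E\<^sub>w) = 2 - (b + j E\<^sub>w, E\<^sub>w)\<close>.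
\<close>

lemma dual_data_monomials:
  assumes b: "b \<in> L_dual \<Gamma>"
  shows "dual_data UNIV (monomials b) (monomials (Z_K \<Gamma> - b))"
  unfolding dual_data_def reflected_def
proof (intro ballI allI)
  fix w j k
  have "pairing b w = of_int \<lfloor>pairing b w\<rfloor>" using b by (simp add: L_dual_iff)
  then have "pairing (Z_K \<Gamma> - b) w = of_int (euler \<Gamma> w + 2 - \<lfloor>pairing b w\<rfloor>)"
    by (simp add: pairing_diff pairing_Z_K)
  then have "self_exponent (Z_K \<Gamma> - b) w (- 1 - j) = 2 - self_exponent b w j"
    unfolding self_exponent_def by (simp only: floor_of_int) (simp add: algebra_simps)
  then show "monomials (Z_K \<Gamma> - b) w (- 1 - j) $$ k = monomials b w j $$ (2 - k)"
    by (auto simp: monomials_nth)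
qed

section \<open>Reduction to the nodes\<close>

text \<open>
  Suppose \<open>l = Z\<^sub>K - r + n\<close> is at least \<open>Z\<^sub>K - r\<close> at all nodes, and put \<open>t = n + E - r\<close>.  The coordinates of \<open>t\<close> are positive
  exactly where \<open>n \<ge> 0\<close>, in particular at the nodes.  Elsewhere \<open>\<delta>\<^sub>w \<le> 2\<close> and \<open>(l, E\<^sub>w) \<le> 0\<close> on the support, so
  \<open>(t, E\<^sub>w) = (l, E\<^sub>w) + \<delta>\<^sub>w - 2 \<le> 0\<close>.  Therefore \<open>t \<ge> 0\<close>, and a zero of \<open>t\<close> would propagate to a node.
\<close>

lemma Q_count_nodes:
  assumes nodes: "nodes \<Gamma> \<noteq> {}" and r: "r \<in> L_dual \<Gamma>" "\<And>v. 0 \<le> r $ v" "\<And>v. r $ v < 1"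
  shows "Q_count \<Gamma> (H_class \<Gamma> (Z_K \<Gamma> - r)) (nodes \<Gamma>) (Z_K \<Gamma> - r)
    = Q_count \<Gamma> (H_class \<Gamma> (Z_K \<Gamma> - r)) UNIV (Z_K \<Gamma> - r)"
proof -
  have key: "(Z_K \<Gamma> - r) $ v \<le> l $ v"
    if l: "l \<in> L_dual \<Gamma>" "z_coeff \<Gamma> l \<noteq> 0" "H_class \<Gamma> l = H_class \<Gamma> (Z_K \<Gamma> - r)"
      and le: "\<forall>v\<in>nodes \<Gamma>. (Z_K \<Gamma> - r) $ v \<le> l $ v" for l v
  proof -
    obtain n where n: "l = Z_K \<Gamma> - r + ivec n" using l(3) H_class_eq_iff by blast
    define t where "t = l - Z_K \<Gamma> + ivec (\<lambda>_. 1)"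
    have t: "t $ w = of_int (n w) + 1 - r $ w" for w by (simp add: t_def n)
    have pos: "0 < t $ w" if "0 \<le> n w" for w
    proof -
      have "(0 :: rat) \<le> of_int (n w)" using that by simp
      then show ?thesis unfolding t using r(3)[of w] by linarith
    qed
    have node: "0 < t $ w" if "w \<in> nodes \<Gamma>" for w
      using le that by (intro pos) (simp add: n)
    have p: "pairing t w \<le> 0" if "t $ w \<le> 0" for w
    proof -
      have "valency \<Gamma> w \<le> 2" using node[of w] that by (force simp: nodes_def)
      then have "(of_nat (valency \<Gamma> w) :: rat) \<le> 2" by simp
      moreover have "pairing (ivec (\<lambda>_. 1)) w = of_int (euler \<Gamma> w) + of_nat (valency \<Gamma> w)"
        by (simp add: pairing_ivec neighbour_sum_def card_neighbours)
      moreover have "pairing l w \<le> 0" by (rule z_coeff_nonzero_pairing[OF l(1,2)])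
      moreover have "pairing t w = pairing l w - pairing (Z_K \<Gamma>) w + pairing (ivec (\<lambda>_. 1)) w"
        by (simp add: t_def pairing_add pairing_diff)
      ultimately show ?thesis by (simp add: pairing_Z_K)
    qed
    have nonneg: "0 \<le> t $ w" for w by (rule nonneg_if_pairing_nonpos) (simp add: p)
    obtain x where x: "x \<in> nodes \<Gamma>" using nodes by blast
    have "t $ v \<noteq> 0"
    proof
      assume "t $ v = 0"
      then have "t $ x = 0" by (rule zero_if_pairing_nonpos[OF nonneg, rotated]) (simp add: p)
      then show False using node[OF x] by simp
    qed
    then have "0 < t $ v" using nonneg[of v] by simp
    then have "(- 1 :: rat) < of_int (n v)" unfolding t using r(2)[of v] by linarith
    then have "of_int (- 1) < (of_int (n v) :: rat)" by simp
    then have "0 \<le> n v" unfolding of_int_less_iff by simp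
    then show ?thesis by (simp add: n)
  qed
  show ?thesis
    unfolding Q_count_def by (intro sum.cong Collect_cong refl) (use key in blast)
qed

section \<open>The normalized Seiberg--Witten invariant\<close>

lemma sum_atLeastLessThan_int: "0 \<le> X \<Longrightarrow> 2 * (\<Sum>j\<in>{0..<X}. (of_int j :: rat)) = of_int (X * (X - 1))"
proof (induction rule: int_ge_induct)
  case (step X)
  have "{0..<X + 1} = insert X {0..<X}" using step.hyps by auto
  then show ?case using step.IH by (simp add: algebra_simps)
qed simp

lemma K_term_difference:
  assumes r: "r \<in> L_dual \<Gamma>"
  shows "K_term \<Gamma> (r + ivec X) - K_term \<Gamma> r
    = (\<Sum>w\<in>UNIV. of_int (X w) * of_int \<lfloor>pairing r w\<rfloor>
        + of_int (X w) * (of_int (euler \<Gamma> w * X w + neighbour_sum UNIV X w) - (of_int (euler \<Gamma> w) + 2)) / 2)"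
proof -
  define c where "c = - Z_K \<Gamma> + 2 *s r"
  define x where "x = ivec X"
  have add: "iform \<Gamma> (y + z) u = iform \<Gamma> y u + iform \<Gamma> z u" for y z u
    by (simp add: iform_eq_pairing pairing_add sum.distrib algebra_simps)
  have scale: "iform \<Gamma> (2 *s y) u = 2 * iform \<Gamma> y u" for y u
    by (simp add: iform_eq_pairing pairing_scale sum_distrib_left algebra_simps)
  have sym: "iform \<Gamma> y u = iform \<Gamma> u y" for y u
    unfolding iform_def using adj_sym
    by (subst sum.swap) (auto intro!: sum.cong simp: intersection_number_def)
  have "- Z_K \<Gamma> + 2 *s (r + x) = c + 2 *s x" by (simp add: c_def vector_add_ldistrib)
  then have "K_term \<Gamma> (r + x) = (iform \<Gamma> (c + 2 *s x) (c + 2 *s x) + of_nat CARD('v)) / 8"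
    by (simp only: K_term_def)
  moreover have "K_term \<Gamma> r = (iform \<Gamma> c c + of_nat CARD('v)) / 8"
    by (simp only: K_term_def c_def)
  ultimately have "8 * (K_term \<Gamma> (r + x) - K_term \<Gamma> r) = iform \<Gamma> (c + 2 *s x) (c + 2 *s x) - iform \<Gamma> c c"
    by simp
  also have "\<dots> = 4 * iform \<Gamma> c x + 4 * iform \<Gamma> x x"
    using sym[of c "c + 2 *s x"] sym[of x "c + 2 *s x"] sym[of x c] by (simp add: add scale)
  also have "\<dots> = (\<Sum>w\<in>UNIV. 4 * (pairing c w + pairing x w) * of_int (X w))"
    by (simp add: iform_eq_pairing x_def sum_distrib_left sum.distrib[symmetric] algebra_simps)
  also have "\<dots> = 8 * (\<Sum>w\<in>UNIV. of_int (X w) * of_int \<lfloor>pairing r w\<rfloor>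
        + of_int (X w) * (of_int (euler \<Gamma> w * X w + neighbour_sum UNIV X w) - (of_int (euler \<Gamma> w) + 2)) / 2)"
    unfolding sum_distrib_left
  proof (rule sum.cong)
    fix w
    have "pairing r w = of_int \<lfloor>pairing r w\<rfloor>" using r by (simp add: L_dual_iff)
    then have pc: "pairing c w = 2 * of_int \<lfloor>pairing r w\<rfloor> - (of_int (euler \<Gamma> w) + 2)"
      unfolding c_def pairing_add pairing_minus pairing_scale pairing_Z_K by linarith
    show "4 * (pairing c w + pairing x w) * of_int (X w) = 8 * (of_int (X w) * of_int \<lfloor>pairing r w\<rfloor>
        + of_int (X w) * (of_int (euler \<Gamma> w * X w + neighbour_sum UNIV X w) - (of_int (euler \<Gamma> w) + 2)) / 2)"
      unfolding pc x_def pairing_ivec by (simp add: field_simps)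
  qed simp
  finally show ?thesis by (simp add: x_def)
qed

text \<open>
  Both points satisfy the cone condition: \<open>r + X\<close> by hypothesis, and \<open>Z\<^sub>K - r\<close> after adding \<open>q = r\<close>.
\<close>

theorem Q_count_duality:
  assumes r: "r \<in> L_dual \<Gamma>" "\<And>v. 0 \<le> r $ v" "\<And>v. r $ v < 1"
    and X: "\<And>w. 0 \<le> X w" and cone: "\<And>w. pairing (r + ivec X) w \<le> pairing (Z_K \<Gamma>) w"
  shows "Q_count \<Gamma> (H_class \<Gamma> r) UNIV (r + ivec X)
      - Q_count \<Gamma> (H_class \<Gamma> (Z_K \<Gamma> - r)) UNIV (Z_K \<Gamma> - r)
    = K_term \<Gamma> r - K_term \<Gamma> (r + ivec X)"
proof -
  have r': "Z_K \<Gamma> - r \<in> L_dual \<Gamma>" by (rule L_dual_diff[OF Z_K_in_L_dual r(1)])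
  have "Q_count \<Gamma> (H_class \<Gamma> r) UNIV (r + ivec X)
      - Q_count \<Gamma> (H_class \<Gamma> (Z_K \<Gamma> - r)) UNIV (Z_K \<Gamma> - r + ivec (\<lambda>_. 0))
    = counting_sum UNIV (monomials r) X - counting_sum UNIV (monomials (Z_K \<Gamma> - r)) (\<lambda>_. 0)"
    by (simp only: counting_sum_monomials[OF r(1)] counting_sum_monomials[OF r'])
  also have "\<dots> = (\<Sum>w\<in>UNIV. \<Sum>j\<in>{0..<X w}. 1 + coeff_sum (excess (monomials r w j)))
      - of_int (\<Sum>w\<in>UNIV. X w * neighbour_sum UNIV X w) / 2"
  proof (rule counting_sum_duality[OF subtree_UNIV])
    show "confining UNIV (monomials r) X"
      by (rule confining_monomials[OF r(1), of 0]) (use cone in simp_all)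
    show "confining UNIV (monomials (Z_K \<Gamma> - r)) (\<lambda>_. 0)"
    proof (rule confining_monomials[OF r' r(2,3)])
      have "Z_K \<Gamma> - r + ivec (\<lambda>_. 0) + r = Z_K \<Gamma>" by (simp add: vec_eq_iff)
      then show "pairing (Z_K \<Gamma> - r + ivec (\<lambda>_. 0) + r) w \<le> pairing (Z_K \<Gamma>) w" for w by simp
    qed
  qed (use X in \<open>simp_all add: admissible_monomials r(1) r' dual_data_monomials\<close>)
  also have "\<dots> = (\<Sum>w\<in>UNIV. (\<Sum>j\<in>{0..<X w}. 1 - of_int (self_exponent r w j)) - of_int (X w * neighbour_sum UNIV X w) / 2)"
    by (simp add: monomials_def coeff_sum_excess_monomial sum_subtractf sum_divide_distrib)
  also have "\<dots> = (\<Sum>w\<in>UNIV. - (of_int (X w) * of_int \<lfloor>pairing r w\<rfloor>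
        + of_int (X w) * (of_int (euler \<Gamma> w * X w + neighbour_sum UNIV X w) - (of_int (euler \<Gamma> w) + 2)) / 2))"
  proof (rule sum.cong)
    fix w
    have S: "(\<Sum>j\<in>{0..<X w}. (of_int j :: rat)) = of_int (X w * (X w - 1)) / 2"
      using sum_atLeastLessThan_int[OF X, of w] by simp
    have "(\<Sum>j\<in>{0..<X w}. 1 - (of_int (self_exponent r w j) :: rat))
      = of_int (X w) * (1 - of_int \<lfloor>pairing r w\<rfloor>) - of_int (euler \<Gamma> w) * (\<Sum>j\<in>{0..<X w}. of_int j)"
      using X[of w] by (simp add: self_exponent_def sum_subtractf sum.distrib sum_distrib_left algebra_simps)
    then show "(\<Sum>j\<in>{0..<X w}. 1 - of_int (self_exponent r w j)) - of_int (X w * neighbour_sum UNIV X w) / 2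
      = - (of_int (X w) * of_int \<lfloor>pairing r w\<rfloor>
        + of_int (X w) * (of_int (euler \<Gamma> w * X w + neighbour_sum UNIV X w) - (of_int (euler \<Gamma> w) + 2)) / 2 :: rat)"
      unfolding S by (simp only:) (simp add: field_simps)
  qed simp
  also have "\<dots> = K_term \<Gamma> r - K_term \<Gamma> (r + ivec X)"
    unfolding sum_negf K_term_difference[OF r(1), of X, symmetric] by simp
  finally have "Q_count \<Gamma> (H_class \<Gamma> r) UNIV (r + ivec X)
      - Q_count \<Gamma> (H_class \<Gamma> (Z_K \<Gamma> - r)) UNIV (Z_K \<Gamma> - r + ivec (\<lambda>_. 0))
    = K_term \<Gamma> r - K_term \<Gamma> (r + ivec X)" .
  moreover have "Z_K \<Gamma> - r + ivec (\<lambda>_. 0) = Z_K \<Gamma> - r" by (simp add: vec_eq_iff)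
  ultimately show ?thesis by (simp only:)
qed

end

theorem corollary4p4p4:
  fixes \<Gamma> :: "('v::finite) plumbing_graph"
    and sw :: "(rat ^ 'v) set \<Rightarrow> rat"
  assumes "plumbing_graph \<Gamma>"
    and "connected_graph \<Gamma>"
    and "negative_definite \<Gamma>"
    and "rational_homology_sphere \<Gamma>"
    and "nemethi_formula \<Gamma> sw"
    and "nodes \<Gamma> \<noteq> {}"
    and "h \<in> carrier (H_group \<Gamma>)"
  shows "Q_count \<Gamma> (H_class \<Gamma> (Z_K \<Gamma>) \<otimes>\<^bsub>H_group \<Gamma>\<^esub> inv\<^bsub>H_group \<Gamma>\<^esub> h) (nodes \<Gamma>)
           (Z_K \<Gamma> - r_rep h) = - sw_norm \<Gamma> sw h"
proof -
  interpret plumbing_tree \<Gamma>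
    using assms(1,3,4) by unfold_locales (simp_all add: rational_homology_sphere_def)
  define r where "r = r_rep h"
  note r = r_rep_properties[OF assms(7), folded r_def]
  have H1: "inv\<^bsub>H_group \<Gamma>\<^esub> h = H_class \<Gamma> (- r)"
    using inv_H_class[OF r(1)] r(2) by simp
  have H2: "H_class \<Gamma> (Z_K \<Gamma>) \<otimes>\<^bsub>H_group \<Gamma>\<^esub> inv\<^bsub>H_group \<Gamma>\<^esub> h = H_class \<Gamma> (Z_K \<Gamma> - r)"
    unfolding H1 using mult_H_class[OF Z_K_in_L_dual L_dual_minus[OF r(1)]] by simp
  (* The surplus 1 puts the point into the open cone, where all coefficients a are positive. *)
  obtain X where X: "\<forall>w. 0 \<le> X w \<and> 0 \<le> X w \<and> pairing (ivec X) w \<le> pairing (Z_K \<Gamma>) w - pairing r w - 1"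
    using exists_deep ..
  define l where "l = r + ivec X"
  define a where "a w = - \<lfloor>pairing (l - Z_K \<Gamma>) w\<rfloor>" for w
  have lL: "l \<in> L_dual \<Gamma>" unfolding l_def by (rule add_ivec_in_L_dual[OF r(1)])
  have a: "- pairing (l - Z_K \<Gamma>) w = of_int (a w)" for w
    using L_dual_diff[OF lL Z_K_in_L_dual] by (simp add: a_def L_dual_iff)
  have le: "pairing l w \<le> pairing (Z_K \<Gamma>) w - 1" for w
    using spec[OF X, of w] by (simp add: l_def pairing_add)
  have "0 < a w" for w
  proof -
    have "(1 :: rat) \<le> of_int (a w)" using a[of w] le[of w] by (simp add: pairing_diff)
    then show ?thesis by simp
  qed
  moreover have l_eq: "Z_K \<Gamma> + (\<Sum>v\<in>UNIV. of_int (a v) *s E_dual \<Gamma> v) = l"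
  proof -
    have "(\<Sum>v\<in>UNIV. of_int (a v) *s E_dual \<Gamma> v) = l - Z_K \<Gamma>"
      unfolding a[symmetric] by (rule sum_E_dual[symmetric])
    then show ?thesis by (simp only: add.commute[of "Z_K \<Gamma>"] diff_add_cancel)
  qed
  ultimately have nemethi: "- Q_count \<Gamma> (H_class \<Gamma> l) UNIV l
      = K_term \<Gamma> l + sw (spinc_act (H_class \<Gamma> (- l)) (sigma_can \<Gamma>))"
    using assms(5)[unfolded nemethi_formula_def Let_def, rule_format, of a] by (simp only: l_eq)
  have cl: "H_class \<Gamma> l = H_class \<Gamma> r" unfolding H_class_eq_iff l_def by blast
  have "- l = - r + ivec (\<lambda>w. - X w)" by (simp add: l_def vec_eq_iff)
  then have cl': "H_class \<Gamma> (- l) = H_class \<Gamma> (- r)" unfolding H_class_eq_iff by blast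
  have "Q_count \<Gamma> (H_class \<Gamma> r) UNIV l - Q_count \<Gamma> (H_class \<Gamma> (Z_K \<Gamma> - r)) UNIV (Z_K \<Gamma> - r)
    = K_term \<Gamma> r - K_term \<Gamma> l"
    unfolding l_def
  proof (rule Q_count_duality[OF r(1,3,4)])
    show "0 \<le> X w" for w using X by blast
    show "pairing (r + ivec X) w \<le> pairing (Z_K \<Gamma>) w" for w using le[of w] by (simp add: l_def)
  qed
  then have "Q_count \<Gamma> (H_class \<Gamma> (Z_K \<Gamma> - r)) UNIV (Z_K \<Gamma> - r) = - sw_norm \<Gamma> sw h"
    using nemethi unfolding cl cl' sw_norm_def H1 r_def[symmetric] by simp
  then show ?thesis
    unfolding H2 r_def[symmetric] Q_count_nodes[OF assms(6) r(1,3,4)] .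
qed

end
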